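(* Let $G=(V,E)$ be a finite connected graph with a boundary vertex $\partial\in V$, and let $\mathcal V$ be a height function potential with dual spin potential $\mathcal U$. Let $h$ be the random height function with $h_\partial=0$ and $\mathrm d h=\mathbf n$, where $\mathbf n\sim\nu_\star$. Let $C=\sup_{e\in E}\big|\mu_\Diamond[\mathcal U''(J_e)]\big|$. Then for any $f\in\Omega^0_0(\mathbb R)$, $$\nu_\star[(h,f)^2]\le C\,(\Delta^{-1}f,f)_{\Omega^0}=C\sum_{v,v'\in V}f_vf_{v'}\frac{\mathbf G(v,v')}{\deg(v')}.$$
   Context: $\mathbb S=\{z\in\mathbb C:|z|=1\}$ is identified with $\mathbb R/2\pi\mathbb Z$ and written additively. For $\mathbb G\in\{\mathbb R,\mathbb Z,\mathbb S\}$ let $\Omega^0(\mathbb G)=\mathbb G^V$, and let $\Omega^1(\mathbb G)$ be the group of antisymmetric functions on directed edges with values in $\mathbb G$ (identified with $\mathbb G^E$ by fixing one orientation of every edge). Set $\mathrm d f_{xy}=f_y-f_x$, $\mathrm d^*\omega_x=\sum_{y\sim x}\omega_{yx}$, $H_\star(\mathbb G)=\mathrm{Im}(\mathrm d)$, $H_\Diamond(\mathbb G)=\ker(\mathrm d^* )$. $\Omega^0_0(\mathbb G)=\{f\in\Omega^0(\mathbb G):f_\partial=0\}$; for each $\mathbf n\in H_\star(\mathbb Z)$ there is a unique $h\in\Omega_0^0(\mathbb Z)$ with $\mathrm dh=\mathbf n$. $(f,g)_{\Omega^0}=\sum_{v\in V}f_vg_v$. $\Delta=\mathrm d^*\mathrm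 d$ is the graph Laplacian, $\Delta^{-1}$ denotes its inverse on $\Omega^0_0(\mathbb R)$ (Dirichlet condition at $\partial$, i.e. the inverse of the matrix of $\Delta$ restricted to $V\setminus\{\partial\}$), and $\mathbf G(v,v')$ is the Green's function (expected number of visits to $v'$ started from $v$) of simple random walk on $G$ killed upon hitting $\partial$ ($\mathbf G=0$ if an argument is $\partial$). Potentials: $\mathcal V:\mathbb Z\to\mathbb R\cup\{+\infty\}$ is a height function potential if $\mathcal V(n)=\mathcal V(-n)$, $\sum_{n\in\mathbb Z}n^2e^{-\mathcal V(n)}<\infty$, and $w(\alpha):=e^{-\mathcal V(0)}+\sum_{n\ge1}2e^{-\mathcal V(n)}\cos(n\alpha)>0$ for all $\alpha\in\mathbb R$. Its dual spin potential is $\mathcal U=-\log w$. Measures: $\nu_\star$ is the probability measure on $H_\star(\mathbb Z)$ with $\nu_\star(\mathbf n)\propto\exp(-\sum_{e\in E}\mathcal V(\mathbf n_e))$; $\mu_\Diamond$ is the probability measure on $H_\Diamond(\mathbb S)$ with $d\mu_\Diamond(J)\propto\prod_{e\in E}w(J_e)\,dJ$, $dJ$ the Haar probability measure. $\nu_\star[\cdot],\mu_\Diamond[\cdot]$ denote expectations. *)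

theory Defs
  imports "HOL-Probability.Probability"
begin

section \<open>The circle group\<close>

text \<open>
  The unit circle as a subset of the complex plane, written additively: addition of angles is
  multiplication of complex numbers of modulus one.
\<close>

typedef circle = "{z :: complex. norm z = 1}"
  by (rule exI[of _ 1]) simp

instantiation circle :: ab_group_add
begin

definition zero_circle :: circle where
  "0 = Abs_circle 1"

definition plus_circle :: "circle \<Rightarrow> circle \<Rightarrow> circle" where
  "x + y = Abs_circle (Rep_circle x * Rep_circle y)"

definition uminus_circle :: "circle \<Rightarrow> circle" where
  "- x = Abs_circle (inverse (Rep_circle x))"

definition minus_circle :: "circle \<Rightarrow> circle \<Rightarrow> circle" where
  "x - y = Abs_circle (Rep_circle x / Rep_circle y)"

lemma norm_Rep_circle [simp]: "norm (Rep_circle x) = 1"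
  using Rep_circle[of x] by simp

lemma Rep_circle_neq_0 [simp]: "Rep_circle x \<noteq> 0"
  using norm_Rep_circle[of x] by fastforce

lemma Rep_circle_zero: "Rep_circle 0 = 1"
  and Rep_circle_plus: "Rep_circle (x + y) = Rep_circle x * Rep_circle y"
  and Rep_circle_uminus: "Rep_circle (- x) = inverse (Rep_circle x)"
  and Rep_circle_minus: "Rep_circle (x - y) = Rep_circle x / Rep_circle y"
  by (simp_all add: zero_circle_def plus_circle_def uminus_circle_def minus_circle_def
      Abs_circle_inverse norm_mult norm_inverse norm_divide)

instance
  by standard
    (simp_all add: Rep_circle_inject[symmetric] Rep_circle_zero Rep_circle_plus
      Rep_circle_uminus Rep_circle_minus field_simps)

end

instantiation circle :: metric_space
begin

definition dist_circle :: "circle \<Rightarrow> circle \<Rightarrow> real" where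
  "dist x y = dist (Rep_circle x) (Rep_circle y)"

definition uniformity_circle :: "(circle \<times> circle) filter" where
  "(uniformity :: (circle \<times> circle) filter) = (INF e\<in>{0<..}. principal {(x, y). dist x y < e})"

definition open_circle :: "circle set \<Rightarrow> bool" where
  "open (U :: circle set) \<longleftrightarrow> (\<forall>x\<in>U. \<forall>\<^sub>F (x', y) in uniformity. x' = x \<longrightarrow> y \<in> U)"

instance
  by standard
    (auto simp: dist_circle_def uniformity_circle_def open_circle_def Rep_circle_inject
      intro: dist_triangle2)

end

text \<open>
  The representative in \<open>(- pi, pi]\<close> of a point of the circle, seen as a class of reals modulo
  \<open>2 * pi\<close>. It will only be used as an argument of \<open>2 * pi\<close>-periodic functions.
\<close>

definition angle :: "circle \<Rightarrow> real" where
  "angle z = Arg (Rep_circle z)"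


section \<open>Graphs and discrete calculus\<close>

text \<open>
  A finite simple graph on the vertex set \<open>UNIV :: 'v set\<close> is given by its edge set \<open>E\<close>
  in which every edge appears with exactly one, arbitrary, orientation. The directed edges are
  the elements of \<open>E \<union> E\<inverse>\<close>.
\<close>

definition oriented_graph :: "('v \<times> 'v) set \<Rightarrow> bool" where
  "oriented_graph E \<longleftrightarrow> (\<forall>x y. (x, y) \<in> E \<longrightarrow> (y, x) \<notin> E)"

definition adj :: "('v \<times> 'v) set \<Rightarrow> 'v \<Rightarrow> 'v \<Rightarrow> bool" where
  "adj E x y \<longleftrightarrow> (x, y) \<in> E \<union> E\<inverse>"

definition connected_graph :: "('v \<times> 'v) set \<Rightarrow> bool" where
  "connected_graph E \<longleftrightarrow> (\<forall>x y. (x, y) \<in> (E \<union> E\<inverse>)\<^sup>*)"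

definition nbrs :: "('v \<times> 'v) set \<Rightarrow> 'v \<Rightarrow> 'v set" where
  "nbrs E x = {y. adj E x y}"

definition deg :: "('v \<times> 'v) set \<Rightarrow> 'v \<Rightarrow> nat" where
  "deg E x = card (nbrs E x)"

text \<open>Zero-forms are arbitrary functions \<open>'v \<Rightarrow> 'g\<close>.\<close>

definition Omega00 :: "'v \<Rightarrow> ('v \<Rightarrow> 'g::ab_group_add) set" where
  "Omega00 b = {f. f b = 0}"

text \<open>One-forms are extended by zero to pairs of vertices that are not directed edges.\<close>

definition Omega1 :: "('v \<times> 'v) set \<Rightarrow> ('v \<times> 'v \<Rightarrow> 'g::ab_group_add) set" where
  "Omega1 E = {\<omega>. (\<forall>x y. \<omega> (y, x) = - \<omega> (x, y)) \<and> (\<forall>x y. \<not> adj E x y \<longrightarrow> \<omega> (x, y) = 0)}"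

definition diff :: "('v \<times> 'v) set \<Rightarrow> ('v \<Rightarrow> 'g::ab_group_add) \<Rightarrow> 'v \<times> 'v \<Rightarrow> 'g" where
  "diff E f = (\<lambda>(x, y). if adj E x y then f y - f x else 0)"

definition codiff :: "('v \<times> 'v) set \<Rightarrow> ('v \<times> 'v \<Rightarrow> 'g::ab_group_add) \<Rightarrow> 'v \<Rightarrow> 'g" where
  "codiff E \<omega> x = (\<Sum>y\<in>nbrs E x. \<omega> (y, x))"

definition H_star :: "('v \<times> 'v) set \<Rightarrow> ('v \<times> 'v \<Rightarrow> 'g::ab_group_add) set" where
  "H_star E = range (diff E)"

definition H_Diamond :: "('v \<times> 'v) set \<Rightarrow> ('v \<times> 'v \<Rightarrow> 'g::ab_group_add) set" where
  "H_Diamond E = {\<omega> \<in> Omega1 E. \<forall>x. codiff E \<omega> x = 0}"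

definition inner0 :: "('v::finite \<Rightarrow> real) \<Rightarrow> ('v \<Rightarrow> real) \<Rightarrow> real" where
  "inner0 f g = (\<Sum>v\<in>UNIV. f v * g v)"

definition height_fun :: "('v \<times> 'v) set \<Rightarrow> 'v \<Rightarrow> ('v \<times> 'v \<Rightarrow> int) \<Rightarrow> 'v \<Rightarrow> int" where
  "height_fun E b n = (THE h. h \<in> Omega00 b \<and> diff E h = n)"

definition Laplace :: "('v \<times> 'v) set \<Rightarrow> ('v \<Rightarrow> real) \<Rightarrow> 'v \<Rightarrow> real" where
  "Laplace E f = codiff E (diff E f)"

text \<open>
  Deleting the row and the column of \<open>b\<close> from the matrix of the Laplacian amounts to
  restricting the operator to \<open>Omega00 b\<close> and resetting the value at \<open>b\<close> of the result to 0.
\<close>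

definition Laplace_inv :: "('v \<times> 'v) set \<Rightarrow> 'v \<Rightarrow> ('v \<Rightarrow> real) \<Rightarrow> 'v \<Rightarrow> real" where
  "Laplace_inv E b = the_inv_into (Omega00 b) (\<lambda>g. (Laplace E g)(b := 0))"


section \<open>Simple random walk and its Green's function\<close>

text \<open>
  \<open>srw_kernel E v n X\<close> is the law of the position at time \<open>n\<close> of simple random walk started
  from \<open>v\<close>, given the positions \<open>X 0, \<dots>, X (n - 1)\<close>. If a vertex has no neighbour, which in a
  connected graph only happens if it is the only vertex, the step is an unspecified law.
\<close>

definition srw_kernel :: "('v::finite \<times> 'v) set \<Rightarrow> 'v \<Rightarrow> nat \<Rightarrow> (nat \<Rightarrow> 'v) \<Rightarrow> 'v measure" where
  "srw_kernel E v n X =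
    measure_pmf (case n of 0 \<Rightarrow> return_pmf v | Suc m \<Rightarrow> pmf_of_set (nbrs E (X m)))"

text \<open>The law of the whole trajectory, from the Ionescu-Tulcea theorem.\<close>

definition srw_law :: "('v::finite \<times> 'v) set \<Rightarrow> 'v \<Rightarrow> (nat \<Rightarrow> 'v) measure" where
  "srw_law E v = projective_family.lim UNIV
    (Ionescu_Tulcea.CI (srw_kernel E v) (\<lambda>_. count_space UNIV)) (\<lambda>_. count_space UNIV)"

lemma Ionescu_Tulcea_srw_kernel:
  fixes E :: "('v::finite \<times> 'v) set"
  shows "Ionescu_Tulcea (srw_kernel E v) (\<lambda>_. count_space UNIV)"
proof (rule Ionescu_Tulcea.intro)
  show "prob_space (srw_kernel E v i x)" for i and x :: "nat \<Rightarrow> 'v"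
    unfolding srw_kernel_def by (rule prob_space_measure_pmf)
  have *: "(\<lambda>x. measure_pmf (p x)) \<in> count_space UNIV \<rightarrow>\<^sub>M subprob_algebra (count_space UNIV)"
    for p :: "'v \<Rightarrow> 'v pmf"
    by (simp add: measure_pmf_in_subprob_algebra)
  show "srw_kernel E v i
      \<in> PiM {0..<i} (\<lambda>_. count_space UNIV) \<rightarrow>\<^sub>M subprob_algebra (count_space UNIV)" for i
  proof (cases i)
    case 0
    then show ?thesis
      unfolding srw_kernel_def by (simp add: measure_pmf_in_subprob_algebra)
  next
    case (Suc m)
    have "(\<lambda>X. X m) \<in> PiM {0..<Suc m} (\<lambda>_. count_space (UNIV :: 'v set)) \<rightarrow>\<^sub>M count_space UNIV"
      by (rule measurable_component_singleton) simp
    from measurable_compose[OF this *[of "\<lambda>x. pmf_of_set (nbrs E x)"]] Suc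
    show ?thesis
      unfolding srw_kernel_def by simp
  qed
qed

text \<open>
  The number of visits to \<open>v'\<close> strictly before the first hitting time of \<open>b\<close>; in particular
  the Green's function vanishes if one of its arguments is \<open>b\<close>.
\<close>

definition killed_visits :: "'v \<Rightarrow> 'v \<Rightarrow> (nat \<Rightarrow> 'v) \<Rightarrow> ennreal" where
  "killed_visits b v' X = emeasure (count_space UNIV) {n. X n = v' \<and> (\<forall>m\<le>n. X m \<noteq> b)}"

definition Green :: "('v::finite \<times> 'v) set \<Rightarrow> 'v \<Rightarrow> 'v \<Rightarrow> 'v \<Rightarrow> real" where
  "Green E b v v' = enn2real (\<integral>\<^sup>+X. killed_visits b v' X \<partial>srw_law E v)"


section \<open>Potentials\<close>

text \<open>The function \<open>exp (- x)\<close>; potentials never take the value \<open>-\<infinity>\<close>.\<close>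

definition exp_neg :: "ereal \<Rightarrow> real" where
  "exp_neg x = (case x of ereal r \<Rightarrow> exp (- r) | PInfty \<Rightarrow> 0 | MInfty \<Rightarrow> undefined)"

definition spin_weight :: "(int \<Rightarrow> ereal) \<Rightarrow> real \<Rightarrow> real" where
  "spin_weight \<V> \<alpha> = exp_neg (\<V> 0) +
    (\<Sum>k. 2 * exp_neg (\<V> (int (Suc k))) * cos (real (Suc k) * \<alpha>))"

definition height_function_potential :: "(int \<Rightarrow> ereal) \<Rightarrow> bool" where
  "height_function_potential \<V> \<longleftrightarrow>
    (\<forall>n. \<V> n \<noteq> -\<infinity>) \<and>
    (\<forall>n. \<V> n = \<V> (- n)) \<and>
    (\<lambda>n. (real_of_int n)\<^sup>2 * exp_neg (\<V> n)) summable_on UNIV \<and>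
    (\<forall>\<alpha>. spin_weight \<V> \<alpha> > 0)"

definition dual_spin_potential :: "(int \<Rightarrow> ereal) \<Rightarrow> real \<Rightarrow> real" where
  "dual_spin_potential \<V> \<alpha> = - ln (spin_weight \<V> \<alpha>)"


section \<open>Measures\<close>

definition height_weight :: "('v::finite \<times> 'v) set \<Rightarrow> (int \<Rightarrow> ereal) \<Rightarrow> ('v \<times> 'v \<Rightarrow> int) \<Rightarrow> real" where
  "height_weight E \<V> n = exp_neg (\<Sum>e\<in>E. \<V> (n e))"

definition nu_star :: "('v::finite \<times> 'v) set \<Rightarrow> (int \<Rightarrow> ereal) \<Rightarrow> ('v \<times> 'v \<Rightarrow> int) measure" where
  "nu_star E \<V> = point_measure (H_star E)
    (\<lambda>n. ennreal (height_weight E \<V> n / infsum (height_weight E \<V>) (H_star E)))"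

text \<open>
  \<open>M\<close> is the Haar probability measure on a closed subgroup \<open>H\<close> of a power of the circle, that
  is, the translation-invariant Borel probability measure on \<open>H\<close>.
\<close>

definition haar_prob :: "('i \<Rightarrow> circle) set \<Rightarrow> ('i \<Rightarrow> circle) measure \<Rightarrow> bool" where
  "haar_prob H M \<longleftrightarrow> prob_space M \<and> sets M = sets (restrict_space borel H) \<and>
    (\<forall>K\<in>H. distr M M (\<lambda>J i. K i + J i) = M)"

definition current_weight ::
    "('v::finite \<times> 'v) set \<Rightarrow> (int \<Rightarrow> ereal) \<Rightarrow> ('v \<times> 'v \<Rightarrow> circle) \<Rightarrow> real" where
  "current_weight E \<V> J = (\<Prod>e\<in>E. spin_weight \<V> (angle (J e)))"

definition mu_Diamond ::
    "('v::finite \<times> 'v) set \<Rightarrow> (int \<Rightarrow> ereal) \<Rightarrow> ('v \<times> 'v \<Rightarrow> circle) measure \<Rightarrow>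
      ('v \<times> 'v \<Rightarrow> circle) measure" where
  "mu_Diamond E \<V> haar = density haar
    (\<lambda>J. ennreal (current_weight E \<V> J / (\<integral>J. current_weight E \<V> J \<partial>haar)))"

end

theory Submission
  imports Defs
begin

text \<open>
  Let \<open>g\<close> be the inverse Laplacian of \<open>f\<close> and \<open>a = d g\<close>. By summation by parts the pairing of
  the height function with \<open>f\<close> is the sum of \<open>n\<^sub>e a\<^sub>e\<close> over the edges. The characters of the group of
  circle-valued circulations that are trivial are exactly the exact integer one-forms, so that for all
  absolutely summable \<open>q\<^sub>e\<close> the sum of \<open>\<Prod>\<^sub>e q\<^sub>e(n\<^sub>e)\<close> over exact \<open>n\<close> is the Haar integral of the product of the
  Fourier series of the \<open>q\<^sub>e\<close>. Applied to \<open>k\<^sup>d exp (- \<V>(k))\<close> with \<open>d \<le> 2\<close>, whose Fourier series are \<open>w\<close>, \<open>- i w'\<close>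
  and \<open>- w''\<close>, this expresses all two-point functions of \<open>n\<close> without differentiating any integral, and
  the second moment becomes \<open>\<Sum>\<^sub>e a\<^sub>e\<^sup>2 \<mu>[\<U>''(J\<^sub>e)] - \<mu>[(\<Sum>\<^sub>e a\<^sub>e \<U>'(J\<^sub>e))\<^sup>2]\<close>. Dropping the square and using that
  \<open>\<Sum>\<^sub>e a\<^sub>e\<^sup>2\<close> is the Dirichlet energy of \<open>g\<close> gives the inequality.
\<close>

section \<open>Discrete calculus and characters\<close>

text \<open>The directed edges split into the disjoint halves \<open>E\<close> and its converse, and
  they are also the pairs of a vertex and a neighbour. The statement lives in an arbitrary
  commutative monoid so that one summation by parts serves both products of circle values and real
  sums.\<close>

lemma (in comm_monoid_set) directed_edges:
  fixes E :: "('v::finite \<times> 'v) set"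
  assumes "oriented_graph E"
  shows "F (\<lambda>(x, y). f (g x y) (g y x)) E = F (\<lambda>x. F (\<lambda>y. g y x) (nbrs E x)) UNIV"
proof -
  have disj: "E \<inter> E\<inverse> = {}"
    using assms by (auto simp: oriented_graph_def)
  have "F (\<lambda>x. F (\<lambda>y. g y x) (nbrs E x)) UNIV = F (\<lambda>(x, y). g y x) (SIGMA x:UNIV. nbrs E x)"
    by (rule Sigma) auto
  also have "(SIGMA x:UNIV. nbrs E x) = E \<union> E\<inverse>"
    by (auto simp: nbrs_def adj_def)
  also have "F (\<lambda>(x, y). g y x) (E \<union> E\<inverse>) = f (F (\<lambda>(x, y). g y x) E) (F (\<lambda>(x, y). g y x) (E\<inverse>))"
    using disj by (intro union_disjoint) auto
  also have "F (\<lambda>(x, y). g y x) (E\<inverse>) = F (\<lambda>(x, y). g x y) E"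
    by (rule reindex_bij_witness[of _ prod.swap prod.swap]) auto
  finally show ?thesis
    by (simp only: distrib[symmetric] case_prod_unfold commute)
qed

section \<open>Antisymmetric one-forms\<close>

lemma Omega1I:
  assumes "\<And>x y. N (y, x) = - N (x, y)" "\<And>x y. \<not> adj E x y \<Longrightarrow> N (x, y) = 0"
  shows "N \<in> Omega1 E"
  using assms unfolding Omega1_def by blast

lemma Omega1D:
  assumes "N \<in> Omega1 E"
  shows "N (y, x) = - N (x, y)" "\<not> adj E x y \<Longrightarrow> N (x, y) = 0"
proof -
  have *: "\<forall>x y. N (y, x) = - N (x, y)" "\<forall>x y. \<not> adj E x y \<longrightarrow> N (x, y) = 0"
    using assms[unfolded Omega1_def] by blast+
  show "N (y, x) = - N (x, y)" by (rule *(1)[rule_format])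
  show "\<not> adj E x y \<Longrightarrow> N (x, y) = 0" by (rule *(2)[rule_format])
qed

lemma Omega1_add:
  assumes "M \<in> Omega1 E" "N \<in> Omega1 E"
  shows "(\<lambda>e. M e + N e) \<in> Omega1 E"
proof (rule Omega1I)
  show "M (y, x) + N (y, x) = - (M (x, y) + N (x, y))" for x y
    by (simp add: Omega1D(1)[OF assms(1), of y x] Omega1D(1)[OF assms(2), of y x])
qed (simp add: Omega1D(2)[OF assms(1)] Omega1D(2)[OF assms(2)])

lemma Omega1_diff:
  assumes "M \<in> Omega1 E" "N \<in> Omega1 E"
  shows "(\<lambda>e. M e - N e) \<in> Omega1 E"
proof (rule Omega1I)
  show "M (y, x) - N (y, x) = - (M (x, y) - N (x, y))" for x y
    by (simp add: Omega1D(1)[OF assms(1), of y x] Omega1D(1)[OF assms(2), of y x])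
qed (simp add: Omega1D(2)[OF assms(1)] Omega1D(2)[OF assms(2)])

lemma diff_on_edge: "(x, y) \<in> E \<Longrightarrow> diff E h (x, y) = h y - h x"
  by (simp add: diff_def adj_def)

section \<open>Characters on circle-valued one-forms\<close>

lemma Rep_circle_sum: "Rep_circle (sum f A) = (\<Prod>x\<in>A. Rep_circle (f x))"
  by (induction A rule: infinite_finite_induct) (auto simp: Rep_circle_zero Rep_circle_plus)

definition circle_cis :: "real \<Rightarrow> circle" where
  "circle_cis t = Abs_circle (cis t)"

lemma Rep_circle_cis [simp]: "Rep_circle (circle_cis t) = cis t"
  by (simp add: circle_cis_def Abs_circle_inverse)

lemma Rep_circle_angle: "Rep_circle z = cis (angle z)"
  by (simp add: angle_def cis_Arg sgn_div_norm)

text \<open>The character with integer frequency vector \<open>m\<close>. Each edge enters in its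
  chosen orientation only, so just the values of \<open>m\<close> on \<open>E\<close> count.\<close>

definition edge_char :: "('v::finite \<times> 'v) set \<Rightarrow> ('v \<times> 'v \<Rightarrow> int) \<Rightarrow> ('v \<times> 'v \<Rightarrow> circle) \<Rightarrow> complex"
  where "edge_char E m J = (\<Prod>e\<in>E. Rep_circle (J e) powi m e)"

lemma norm_edge_char [simp]: "norm (edge_char E m J) = 1"
  by (simp add: edge_char_def prod_norm[symmetric] norm_power_int)

lemma edge_char_add: "edge_char E m (\<lambda>e. J e + K e) = edge_char E m J * edge_char E m K"
  by (simp add: edge_char_def Rep_circle_plus power_int_mult_distrib prod.distrib)

lemma power_int_prod: "(\<Prod>x\<in>A. f x) powi n = (\<Prod>x\<in>A. (f x :: complex) powi n)"
  by (induction A rule: infinite_finite_induct) (auto simp: power_int_mult_distrib)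

lemma H_Diamond_minus: "J \<in> H_Diamond E \<Longrightarrow> J (y, x) = - J (x, y)"
  by (rule Omega1D(1)[of J E]) (simp add: H_Diamond_def)

text \<open>Multiplicative summation by parts: antisymmetry of \<open>J\<close> splits the factor of
  an edge into one power per endpoint, and the powers collected at \<open>x\<close> form the
  divergence of \<open>J\<close> at \<open>x\<close> raised to \<open>h x\<close>, which is
  trivial.\<close>

lemma edge_char_diff:
  assumes "oriented_graph E" "J \<in> H_Diamond E"
  shows "edge_char E (diff E h) J = 1"
proof -
  let ?g = "\<lambda>x y. Rep_circle (J (x, y)) powi h y"
  have "edge_char E (diff E h) J = (\<Prod>(x, y)\<in>E. ?g x y * ?g y x)"
    unfolding edge_char_def
  proof (rule prod.cong[OF refl], clarify)
    fix x y assume "(x, y) \<in> E"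
    then show "Rep_circle (J (x, y)) powi diff E h (x, y) = ?g x y * ?g y x"
      using H_Diamond_minus[OF assms(2), of y x]
      by (simp add: diff_on_edge Rep_circle_uminus power_int_diff power_int_inverse field_simps)
  qed
  also have "\<dots> = (\<Prod>x\<in>UNIV. \<Prod>y\<in>nbrs E x. ?g y x)"
    by (rule prod.directed_edges[OF assms(1)])
  also have "\<dots> = (\<Prod>x\<in>UNIV. Rep_circle (codiff E J x) powi h x)"
    by (simp add: codiff_def Rep_circle_sum power_int_prod)
  also have "\<dots> = 1"
    using assms(2) by (simp add: H_Diamond_def Rep_circle_zero)
  finally show ?thesis .
qed

lemma edge_char_cong: "(\<And>e. e \<in> E \<Longrightarrow> m e = m' e) \<Longrightarrow> edge_char E m J = edge_char E m' J"
  by (auto simp: edge_char_def intro: prod.cong)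

lemma codiff_add: "codiff E (\<lambda>e. M e + N e) x = codiff E M x + codiff E N x"
  by (simp add: codiff_def sum.distrib)

lemma codiff_diff: "codiff E (\<lambda>e. M e - N e) x = codiff E M x - codiff E N x"
  by (simp add: codiff_def sum_subtractf)

text \<open>The unit flow from \<open>x\<close> to \<open>y\<close> along a single edge, the
  building block of flows along paths.\<close>

definition edge_form :: "'v \<Rightarrow> 'v \<Rightarrow> 'v \<times> 'v \<Rightarrow> int" where
  "edge_form x y = (\<lambda>e. of_bool (e = (x, y)) - of_bool (e = (y, x)))"

lemma edge_form_Omega1:
  assumes "adj E x y"
  shows "edge_form x y \<in> Omega1 E"
proof (rule Omega1I)
  show "edge_form x y (v, u) = - edge_form x y (u, v)" for u v
    by (simp add: edge_form_def conj_commute)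
  show "edge_form x y (u, v) = 0" if "\<not> adj E u v" for u v
  proof -
    have "(u, v) \<noteq> (x, y)" "(u, v) \<noteq> (y, x)"
      using assms that by (auto simp: adj_def)
    then show ?thesis by (simp only: edge_form_def of_bool_eq diff_self simp_thms)
  qed
qed

lemma codiff_edge_form:
  fixes E :: "('v::finite \<times> 'v) set"
  assumes "adj E x y"
  shows "codiff E (edge_form x y) z = of_bool (z = y) - of_bool (z = x)"
proof -
  have "adj E y x" using assms by (auto simp: adj_def)
  have *: "(\<Sum>y'\<in>nbrs E z. of_bool ((y', z) = (u, v))) = (of_bool (z = v) :: int)" if "adj E u v" for u v
  proof -
    have "(\<Sum>y'\<in>nbrs E z. of_bool ((y', z) = (u, v))) = (\<Sum>y'\<in>nbrs E z. if y' = u then of_bool (z = v) else (0::int))"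
      by (rule sum.cong) auto
    also have "\<dots> = of_bool (z = v)"
      using that by (subst sum.delta) (auto simp: nbrs_def adj_def)
    finally show ?thesis .
  qed
  show ?thesis
    unfolding codiff_def edge_form_def sum_subtractf
    by (simp only: *[OF assms] *[OF \<open>adj E y x\<close>])
qed

text \<open>Unit flows are added up along a path from \<open>b\<close> to \<open>v\<close>; the
  divergences at the intermediate vertices cancel.\<close>

lemma exists_flow:
  fixes E :: "('v::finite \<times> 'v) set"
  assumes "connected_graph E"
  shows "\<exists>N\<in>Omega1 E. \<forall>z. codiff E N z = (of_bool (z = v) - of_bool (z = b) :: int)"
proof -
  have "(b, v) \<in> (E \<union> E\<inverse>)\<^sup>*"
    using assms by (simp add: connected_graph_def)
  then show ?thesis
  proof (induction v rule: rtrancl_induct)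
    case base
    show ?case
      by (rule bexI[of _ "\<lambda>_. 0"]) (auto simp: codiff_def Omega1_def)
  next
    case (step x y)
    then obtain N where N: "N \<in> Omega1 E" "\<And>z. codiff E N z = (of_bool (z = x) - of_bool (z = b) :: int)"
      by blast
    have a: "adj E x y" using step by (simp add: adj_def)
    have "(\<lambda>e. N e + edge_form x y e) \<in> Omega1 E"
      using N(1) edge_form_Omega1[OF a] by (rule Omega1_add)
    moreover have "codiff E (\<lambda>e. N e + edge_form x y e) z = (of_bool (z = y) - of_bool (z = b) :: int)" for z
      by (simp add: codiff_add N codiff_edge_form[OF a])
    ultimately show ?case by blast
  qed
qed

text \<open>An integer circulation spans a one-parameter group of circle-valued circulations. A
  character that is trivial on this group must have zero pairing with the circulation.\<close>

lemma circulation_orthogonal: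
  fixes E :: "('v::finite \<times> 'v) set"
  assumes triv: "\<And>J. J \<in> H_Diamond E \<Longrightarrow> edge_char E m J = 1"
    and N: "N \<in> Omega1 E" "\<And>z. codiff E N z = (0::int)"
  shows "(\<Sum>e\<in>E. m e * N e) = 0"
proof (rule ccontr)
  define s where "s = (\<Sum>e\<in>E. m e * N e)"
  assume "(\<Sum>e\<in>E. m e * N e) \<noteq> 0"
  then have s: "s \<noteq> 0" by (simp add: s_def)
  \<comment> \<open>With this angle a pairing of size \<open>s\<close> amounts to a half turn, so
    the character takes the value -1 at \<open>J\<close>.\<close>
  define \<theta> where "\<theta> = pi / of_int s"
  define J where "J = (\<lambda>e. circle_cis (\<theta> * of_int (N e)))"
  have "J \<in> H_Diamond E"
  proof -
    have "J (y, x) = - J (x, y)" for x y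
      using Omega1D(1)[OF N(1), of y x]
      by (simp add: J_def Rep_circle_inject[symmetric] Rep_circle_uminus)
    moreover have "\<not> adj E x y \<Longrightarrow> J (x, y) = 0" for x y
      using Omega1D(2)[OF N(1)]
      by (simp add: J_def Rep_circle_inject[symmetric] Rep_circle_zero)
    moreover have "codiff E J z = 0" for z
    proof -
      have "Rep_circle (codiff E J z) = cis (\<theta> * of_int (codiff E N z))"
      proof -
        have "(\<Prod>x\<in>A. cis (\<theta> * of_int (N (x, z)))) = cis (\<theta> * of_int (\<Sum>x\<in>A. N (x, z)))" for A
          by (induction A rule: infinite_finite_induct) (auto simp: cis_mult algebra_simps)
        then show ?thesis
          by (simp add: codiff_def Rep_circle_sum J_def)
      qed
      also have "\<dots> = 1" by (simp add: N)
      finally show ?thesis by (simp add: Rep_circle_inject[symmetric] Rep_circle_zero)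
    qed
    ultimately show ?thesis
      unfolding H_Diamond_def by (intro CollectI conjI Omega1I allI) blast+
  qed
  from triv[OF this] have "1 = edge_char E m J" by simp
  also have "\<dots> = (\<Prod>e\<in>E. cis (\<theta> * of_int (m e * N e)))"
    unfolding edge_char_def J_def
    by (rule prod.cong) (auto simp: cis_power_int algebra_simps)
  also have "\<dots> = cis (\<theta> * of_int s)"
  proof -
    have "(\<Prod>e\<in>A. cis (\<theta> * of_int (m e * N e))) = cis (\<theta> * of_int (\<Sum>e\<in>A. m e * N e))" for A
      by (induction A rule: infinite_finite_induct) (auto simp: cis_mult algebra_simps)
    then show ?thesis by (simp add: s_def)
  qed
  also have "\<dots> = -1"
    using s by (simp add: \<theta>_def)
  finally show False by simp
qed

text \<open>The height at \<open>v\<close> is the pairing of \<open>m\<close> with a unit flow from \<open>b\<close> to \<open>v\<close>.\<close>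

lemma trivial_char_exact:
  fixes E :: "('v::finite \<times> 'v) set"
  assumes "oriented_graph E" "connected_graph E"
    and triv: "\<And>J. J \<in> H_Diamond E \<Longrightarrow> edge_char E m J = 1"
  shows "\<exists>h. \<forall>e\<in>E. m e = diff E h e"
proof -
  \<comment> \<open>An arbitrary base vertex, at which the height is normalised.\<close>
  fix b :: 'v
  obtain N where N: "\<And>v. N v \<in> Omega1 E"
      "\<And>v z. codiff E (N v) z = (of_bool (z = v) - of_bool (z = b) :: int)"
    using exists_flow[OF assms(2), of _ b] by metis
  define h where "h v = (\<Sum>e\<in>E. m e * N v e)" for v
  have "m (x, y) = h y - h x" if xy: "(x, y) \<in> E" for x y
  proof -
    have a: "adj E x y" and yx: "(y, x) \<notin> E" 
      using xy assms(1) by (auto simp: adj_def oriented_graph_def)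
    \<comment> \<open>The flow to \<open>x\<close>, continued along the edge to \<open>y\<close> and
      returned by the flow to \<open>y\<close>, closes up to a circulation.\<close>
    let ?N = "\<lambda>e. N x e + edge_form x y e - N y e"
    have "?N \<in> Omega1 E"
      using N(1) edge_form_Omega1[OF a] by (intro Omega1_diff Omega1_add)
    moreover have "codiff E ?N z = 0" for z
      by (simp add: codiff_add codiff_diff N codiff_edge_form[OF a])
    ultimately have "(\<Sum>e\<in>E. m e * ?N e) = 0"
      using circulation_orthogonal[OF triv] by blast
    moreover have "(\<Sum>e\<in>E. m e * edge_form x y e) = m (x, y)"
    proof -
      have "(\<Sum>e\<in>E. m e * edge_form x y e) = (\<Sum>e\<in>E. if e = (x, y) then m e else 0)"
        using yx by (intro sum.cong) (auto simp: edge_form_def)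
      also have "\<dots> = m (x, y)"
        using xy by (subst sum.delta) auto
      finally show ?thesis .
    qed
    ultimately show ?thesis
      by (simp add: h_def algebra_simps sum.distrib sum_subtractf)
  qed
  then show ?thesis
    by (intro exI[of _ h]) (auto simp: diff_on_edge)
qed

section \<open>Haar measure and duality\<close>

lemma continuous_on_Rep_circle: "continuous_on A Rep_circle"
  unfolding continuous_on_iff dist_circle_def by auto

lemma continuous_on_coordinate:
  fixes e :: 'i
  shows "continuous_on A (\<lambda>J :: 'i \<Rightarrow> circle. J e)"
  by (rule continuous_on_subset[OF continuous_on_product_coordinates subset_UNIV])

lemma haar_measurableI:
  assumes "haar_prob H M" "f \<in> borel_measurable borel"
  shows "f \<in> borel_measurable M"
proof -
  have "f \<in> borel_measurable (restrict_space borel H)"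
    using assms(2) by (rule measurable_restrict_space1)
  moreover have "sets M = sets (restrict_space borel H)"
    using assms(1) by (simp add: haar_prob_def)
  ultimately show ?thesis
    by (simp cong: measurable_cong_sets)
qed

lemma haar_space: "haar_prob H M \<Longrightarrow> space M = H"
  using sets_eq_imp_space_eq[of M "restrict_space borel H"] by (simp add: haar_prob_def space_restrict_space)

lemma measurable_coordinate:
  fixes e :: 'i
  assumes "haar_prob H M"
  shows "(\<lambda>J. Rep_circle (J e)) \<in> borel_measurable M"
proof (rule haar_measurableI[OF assms])
  have "continuous_on UNIV (\<lambda>J :: 'i \<Rightarrow> circle. Rep_circle (J e))"
    by (rule continuous_on_compose2[OF continuous_on_Rep_circle continuous_on_coordinate]) (rule subset_UNIV)
  then show "(\<lambda>J :: 'i \<Rightarrow> circle. Rep_circle (J e)) \<in> borel_measurable borel"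
    by (rule borel_measurable_continuous_onI)
qed

lemma measurable_edge_char:
  assumes "haar_prob H M"
  shows "edge_char E m \<in> borel_measurable M"
proof -
  have "(\<lambda>z. z powi n) \<in> borel_measurable (borel :: complex measure)" for n
    by (cases n) (auto simp: power_int_def)
  from measurable_compose[OF measurable_coordinate[OF assms] this]
  show ?thesis
    unfolding edge_char_def[abs_def] by measurable
qed

text \<open>Invariance of the Haar measure is stated through \<open>distr\<close>; transporting an
  integral along a translation also requires its measurability.\<close>

lemma measurable_translation:
  fixes H :: "('i \<Rightarrow> circle) set"
  assumes "haar_prob H M" "K \<in> H" "\<And>J. J \<in> H \<Longrightarrow> (\<lambda>i. K i + J i) \<in> H"
  shows "(\<lambda>J i. K i + J i) \<in> M \<rightarrow>\<^sub>M M"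
proof -
  have sM: "sets M = sets (restrict_space borel H)"
    using assms(1) by (simp add: haar_prob_def)
  have "continuous_on UNIV (\<lambda>J i. K i + J i :: circle)"
  proof (rule continuous_on_coordinatewise_then_product)
    fix i
    \<comment> \<open>Translation on the circle is multiplication by a number of modulus 1, hence an
      isometry.\<close>
    have "continuous_on UNIV (\<lambda>z. K i + z)"
      unfolding continuous_on_iff dist_circle_def dist_norm
      by (auto simp: Rep_circle_plus right_diff_distrib[symmetric] norm_mult)
    then show "continuous_on UNIV (\<lambda>J. K i + J i)"
      by (rule continuous_on_compose2[OF _ continuous_on_coordinate]) simp
  qed
  then have "(\<lambda>J i. K i + J i) \<in> borel_measurable borel"
    by (rule borel_measurable_continuous_onI)
  then have "(\<lambda>J i. K i + J i) \<in> restrict_space borel H \<rightarrow>\<^sub>M restrict_space borel H"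
    using assms(3) by (intro measurable_restrict_space3) auto
  then show ?thesis
    by (simp cong: measurable_cong_sets add: measurable_cong_sets[OF sM sM])
qed

section \<open>Orthogonality of characters\<close>

lemma H_Diamond_add:
  assumes "K \<in> H_Diamond E" "J \<in> H_Diamond E"
  shows "(\<lambda>e. K e + J e) \<in> H_Diamond E"
  using assms by (auto simp: H_Diamond_def codiff_add intro: Omega1_add)

text \<open>A character that is not exact on \<open>E\<close> differs from 1 at some circulation
  \<open>K\<close>. Translation by \<open>K\<close> multiplies the integral by that value and
  preserves it, so the integral vanishes.\<close>

lemma integral_edge_char:
  fixes E :: "('v::finite \<times> 'v) set"
  assumes "oriented_graph E" "connected_graph E" and haar: "haar_prob (H_Diamond E) M"
  shows "(\<integral>J. edge_char E m J \<partial>M) = of_bool (\<exists>h. \<forall>e\<in>E. m e = diff E h e)"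
proof (cases "\<exists>h. \<forall>e\<in>E. m e = diff E h e")
  case True
  interpret prob_space M using haar by (simp add: haar_prob_def)
  from True obtain h where h: "\<forall>e\<in>E. m e = diff E h e" by blast
  have "(\<integral>J. edge_char E m J \<partial>M) = (\<integral>J. 1 \<partial>M)"
    using edge_char_diff[OF assms(1), of _ h] h edge_char_cong[of E m "diff E h"]
    by (intro Bochner_Integration.integral_cong) (auto simp: haar_space[OF haar])
  then show ?thesis using True by (simp add: prob_space)
next
  case False
  then obtain K where K: "K \<in> H_Diamond E" "edge_char E m K \<noteq> 1"
    using trivial_char_exact[OF assms(1,2), of m] by blast
  have T: "(\<lambda>J i. K i + J i) \<in> M \<rightarrow>\<^sub>M M"
    using measurable_translation[OF haar K(1)] H_Diamond_add[OF K(1)] by blast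
  have "(\<integral>J. edge_char E m J \<partial>M) = (\<integral>J. edge_char E m J \<partial>distr M M (\<lambda>J i. K i + J i))"
    using haar K(1) by (simp add: haar_prob_def)
  also have "\<dots> = (\<integral>J. edge_char E m (\<lambda>i. K i + J i) \<partial>M)"
    by (rule integral_distr[OF T measurable_edge_char[OF haar]])
  also have "\<dots> = edge_char E m K * (\<integral>J. edge_char E m J \<partial>M)"
    by (simp add: edge_char_add)
  finally show ?thesis
    using K(2) False by simp
qed

text \<open>Restriction to \<open>E\<close> carries the sum over one-forms, which are functions on
  all pairs, to extensional functions on \<open>E\<close>, where sums of products factorise. The
  values on one orientation determine an exact form.\<close>

lemma bij_betw_H_star:
  fixes E :: "('v::finite \<times> 'v) set"
  shows "bij_betw (\<lambda>n. restrict n E) (H_star E)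
    {m \<in> PiE E (\<lambda>_. UNIV :: int set). \<exists>h. \<forall>e\<in>E. m e = diff E h e}"
proof (rule bij_betw_imageI)
  show "inj_on (\<lambda>n. restrict n E) (H_star E :: ('v \<times> 'v \<Rightarrow> int) set)"
  proof (rule inj_onI)
    fix n n' :: "'v \<times> 'v \<Rightarrow> int"
    assume n: "n \<in> H_star E" "n' \<in> H_star E" and eq: "restrict n E = restrict n' E"
    from n obtain h h' where h: "n = diff E h" "n' = diff E h'"
      by (auto simp: H_star_def)
    have "n e = n' e" if "e \<in> E" for e
      using fun_cong[OF eq, of e] that by simp
    then have *: "h y - h x = h' y - h' x" if "(x, y) \<in> E" for x y
      using that unfolding h by (auto simp: diff_on_edge)
    have "diff E h (x, y) = diff E h' (x, y)" for x y
      using *[of x y] *[of y x] by (auto simp: diff_def adj_def algebra_simps)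
    then show "n = n'"
      unfolding h by auto
  qed
  show "(\<lambda>n. restrict n E) ` H_star E = {m \<in> PiE E (\<lambda>_. UNIV :: int set). \<exists>h. \<forall>e\<in>E. m e = diff E h e}"
  proof (intro equalityI subsetI)
    fix m assume "m \<in> {m \<in> PiE E (\<lambda>_. UNIV :: int set). \<exists>h. \<forall>e\<in>E. m e = diff E h e}"
    then obtain h where "m \<in> extensional E" "\<forall>e\<in>E. m e = diff E h e"
      by (auto simp: PiE_def)
    then have "m = restrict (diff E h) E"
      by (auto simp: extensional_def restrict_def)
    then show "m \<in> (\<lambda>n. restrict n E) ` H_star E"
      by (auto simp: H_star_def)
  qed (auto simp: H_star_def)
qed

text \<open>A form of Poisson summation: the sum over exact forms is extended to all integer
  functions on \<open>E\<close>, exactness being detected by the Haar integral of a character. After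
  Fubini the inner sum factorises over the edges.\<close>

lemma
  fixes E :: "('v::finite \<times> 'v) set" and q :: "'v \<times> 'v \<Rightarrow> int \<Rightarrow> complex"
  assumes "oriented_graph E" "connected_graph E" and haar: "haar_prob (H_Diamond E) M"
    and q: "\<And>e. e \<in> E \<Longrightarrow> integrable (count_space UNIV) (q e)"
  shows integrable_height_dual: "integrable (count_space (H_star E)) (\<lambda>n. \<Prod>e\<in>E. q e (n e))"
    and integral_height_dual: "(\<integral>n. (\<Prod>e\<in>E. q e (n e)) \<partial>count_space (H_star E)) =
      (\<integral>J. (\<Prod>e\<in>E. \<integral>k. q e k * Rep_circle (J e) powi k \<partial>count_space UNIV) \<partial>M)"
proof -
  interpret prob_space M using haar by (simp add: haar_prob_def)
  define S where "S = PiE E (\<lambda>_. UNIV :: int set)"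
  define X where "X = {m \<in> S. \<exists>h. \<forall>e\<in>E. m e = diff E h e}"
  have X: "X \<subseteq> S" by (auto simp: X_def)
  have bij: "bij_betw (\<lambda>n. restrict n E) (H_star E) X"
    unfolding X_def S_def by (rule bij_betw_H_star)
  have cS: "countable S"
    unfolding S_def by (rule countable_PiE) auto
  interpret S: sigma_finite_measure "count_space S"
    using cS by (rule sigma_finite_measure_count_space_countable)
  interpret P: pair_sigma_finite "count_space S" M ..
  let ?Q = "\<lambda>m. \<Prod>e\<in>E. q e (m e)"
  have QS: "integrable (count_space S) ?Q"
    using abs_summable_on_prod_PiE[of E "\<lambda>_. UNIV" q] q
    by (simp add: S_def abs_summable_on_def)
  then have QX: "integrable (count_space X) ?Q"
    using abs_summable_on_subset[of ?Q S X] X by (simp add: abs_summable_on_def)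
  show "integrable (count_space (H_star E)) ?Q"
    using integrable_bij_count_space[OF bij, of ?Q] QX by simp
  have char: "integrable M (edge_char E m)" for m
    by (rule integrable_const_bound[where B=1]) (auto simp: measurable_edge_char[OF haar])
  \<comment> \<open>Characters have modulus 1, so joint integrability reduces to absolute
    summability of the products of the \<open>q e\<close>.\<close>
  have int: "integrable (count_space S \<Otimes>\<^sub>M M) (\<lambda>(m, J). ?Q m * edge_char E m J)"
  proof (rule P.Fubini_integrable)
    show "(\<lambda>(m, J). ?Q m * edge_char E m J) \<in> borel_measurable (count_space S \<Otimes>\<^sub>M M)"
      using measurable_edge_char[OF haar]
      by (intro measurable_pair_measure_countable1[OF cS]) auto
    show "integrable (count_space S) (\<lambda>m. \<integral>J. norm (case (m, J) of (m, J) \<Rightarrow> ?Q m * edge_char E m J) \<partial>M)"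
      using integrable_norm[OF QS] by (simp add: norm_mult prob_space)
    show "AE m in count_space S. integrable M (\<lambda>J. case (m, J) of (m, J) \<Rightarrow> ?Q m * edge_char E m J)"
      using char by simp
  qed
  have "(\<integral>n. ?Q n \<partial>count_space (H_star E)) = (\<integral>n. ?Q (restrict n E) \<partial>count_space (H_star E))"
    by (intro Bochner_Integration.integral_cong prod.cong) auto
  also have "\<dots> = (\<integral>m. ?Q m \<partial>count_space X)"
    by (rule integral_bij_count_space[OF bij])
  also have "\<dots> = infsetsum ?Q X"
    by (simp add: infsetsum_def)
  also have "\<dots> = infsetsum (\<lambda>m. ?Q m * of_bool (\<exists>h. \<forall>e\<in>E. m e = diff E h e)) S"
    by (rule infsetsum_cong_neutral) (auto simp: X_def)
  \<comment> \<open>Orthogonality replaces the indicator of exactness by the integral of the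
    character.\<close>
  also have "\<dots> = (\<integral>m. (\<integral>J. ?Q m * edge_char E m J \<partial>M) \<partial>count_space S)"
    unfolding infsetsum_def using integral_edge_char[OF assms(1-3)] by simp
  also have "\<dots> = (\<integral>J. (\<integral>m. ?Q m * edge_char E m J \<partial>count_space S) \<partial>M)"
    using P.Fubini_integral[OF int] by simp
  also have "\<dots> = (\<integral>J. (\<Prod>e\<in>E. \<integral>k. q e k * Rep_circle (J e) powi k \<partial>count_space UNIV) \<partial>M)"
  proof (rule Bochner_Integration.integral_cong[OF refl])
    fix J
    have "(\<integral>m. ?Q m * edge_char E m J \<partial>count_space S) =
        infsetsum (\<lambda>m. \<Prod>e\<in>E. q e (m e) * Rep_circle (J e) powi (m e)) S"
      by (simp add: edge_char_def prod.distrib infsetsum_def)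
    also have "\<dots> = (\<Prod>e\<in>E. infsetsum (\<lambda>k. q e k * Rep_circle (J e) powi k) UNIV)"
      unfolding S_def
    proof (rule infsetsum_prod_PiE)
      fix e assume "e \<in> E"
      then show "Infinite_Set_Sum.abs_summable_on (\<lambda>k. q e k * Rep_circle (J e) powi k) UNIV"
        unfolding abs_summable_on_def
        by (intro Bochner_Integration.integrable_bound[OF q]) (auto simp: norm_mult norm_power_int)
    qed auto
    finally show "(\<integral>m. ?Q m * edge_char E m J \<partial>count_space S) =
      (\<Prod>e\<in>E. \<integral>k. q e k * Rep_circle (J e) powi k \<partial>count_space UNIV)"
      by (simp add: infsetsum_def)
  qed
  finally show "(\<integral>n. (\<Prod>e\<in>E. q e (n e)) \<partial>count_space (H_star E)) =
      (\<integral>J. (\<Prod>e\<in>E. \<integral>k. q e k * Rep_circle (J e) powi k \<partial>count_space UNIV) \<partial>M)" .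
qed

section \<open>The Laplacian with Dirichlet condition\<close>

lemma connected_const:
  fixes h :: "'v \<Rightarrow> 'g"
  assumes "connected_graph E" "\<And>x y. (x, y) \<in> E \<Longrightarrow> h x = h y"
  shows "h x = h y"
proof -
  have "(x, y) \<in> (E \<union> E\<inverse>)\<^sup>*"
    using assms(1) by (simp add: connected_graph_def)
  then show ?thesis
    by (induction rule: rtrancl_induct) (auto dest: assms(2))
qed

section \<open>Height functions\<close>

lemma diff_inj:
  fixes h h' :: "'v \<Rightarrow> 'g::ab_group_add"
  assumes "connected_graph E" "diff E h = diff E h'" "h b = h' b"
  shows "h = h'"
proof
  fix x
  have "h x - h' x = h y - h' y" if "(x, y) \<in> E" for x y
    using fun_cong[OF assms(2), of "(x, y)"] that
    by (simp add: diff_on_edge algebra_simps)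
  from connected_const[OF assms(1), of "\<lambda>x. h x - h' x", OF this, of x b] show "h x = h' x"
    using assms(3) by simp
qed

text \<open>Justifies the definite description: subtracting from a primitive its value at
  \<open>b\<close> gives existence, and connectedness gives uniqueness.\<close>

lemma height_fun:
  fixes n :: "'v \<times> 'v \<Rightarrow> int"
  assumes "connected_graph E" "n \<in> H_star E"
  shows "height_fun E b n b = 0" "diff E (height_fun E b n) = n"
proof -
  obtain h where h: "n = diff E h" using assms(2) by (auto simp: H_star_def)
  have "\<exists>!h. h \<in> Omega00 b \<and> diff E h = n"
  proof (rule ex1I[of _ "\<lambda>v. h v - h b"])
    show "(\<lambda>v. h v - h b) \<in> Omega00 b \<and> diff E (\<lambda>v. h v - h b) = n"
      by (auto simp: Omega00_def h diff_def)
  next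
    fix h' assume "h' \<in> Omega00 b \<and> diff E h' = n"
    then show "h' = (\<lambda>v. h v - h b)"
      by (intro diff_inj[OF assms(1), where b=b]) (auto simp: Omega00_def h diff_def)
  qed
  from theI'[OF this] show "height_fun E b n b = 0" "diff E (height_fun E b n) = n"
    by (auto simp: height_fun_def Omega00_def)
qed

section \<open>Green's identity and the Dirichlet problem\<close>

lemma Laplace_alt: "Laplace E f x = (\<Sum>y\<in>nbrs E x. f x - f y)"
  unfolding Laplace_def codiff_def by (rule sum.cong) (auto simp: nbrs_def diff_def adj_def)

lemma Laplace_deg:
  fixes E :: "('v::finite \<times> 'v) set"
  shows "Laplace E f x = real (deg E x) * f x - (\<Sum>y\<in>nbrs E x. f y)"
  by (simp add: Laplace_alt sum_subtractf deg_def)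

lemma Green_identity:
  fixes E :: "('v::finite \<times> 'v) set"
  assumes "oriented_graph E"
  shows "inner0 h (Laplace E g) = (\<Sum>e\<in>E. diff E h e * diff E g e)"
proof -
  have "inner0 h (Laplace E g) = (\<Sum>x\<in>UNIV. \<Sum>y\<in>nbrs E x. h x * (g x - g y))"
    by (simp add: inner0_def Laplace_alt sum_distrib_left)
  also have "\<dots> = (\<Sum>(x, y)\<in>E. h y * (g y - g x) + h x * (g x - g y))"
    by (rule sum.directed_edges[OF assms, symmetric])
  also have "\<dots> = (\<Sum>e\<in>E. diff E h e * diff E g e)"
    by (rule sum.cong) (auto simp: diff_on_edge algebra_simps)
  finally show ?thesis .
qed

lemma Laplace_linear:
  fixes E :: "('v::finite \<times> 'v) set"
  shows "Laplace E (\<lambda>v. f v + g v) x = Laplace E f x + Laplace E g x"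
    and "Laplace E (\<lambda>v. c * f v) x = c * Laplace E f x"
    and "Laplace E (\<lambda>v. f v - g v) x = Laplace E f x - Laplace E g x"
  by (simp_all add: Laplace_deg sum.distrib sum_subtractf sum_distrib_left algebra_simps)

text \<open>At every vertex either \<open>g\<close> or its Laplacian vanishes, so the Dirichlet
  energy is zero and \<open>g\<close> is constant.\<close>

lemma Laplace_Dirichlet_zero:
  fixes E :: "('v::finite \<times> 'v) set"
  assumes "oriented_graph E" "connected_graph E" "g b = 0" "\<And>x. x \<noteq> b \<Longrightarrow> Laplace E g x = 0"
  shows "g x = 0"
proof -
  have "inner0 g (Laplace E g) = 0"
    unfolding inner0_def using assms(3,4) by (intro sum.neutral) (metis mult_eq_0_iff)
  then have "(\<Sum>e\<in>E. (diff E g e)\<^sup>2) = 0"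
    by (simp add: Green_identity[OF assms(1)] power2_eq_square)
  then have "\<forall>e\<in>E. diff E g e = 0"
    by (subst (asm) sum_nonneg_eq_0_iff) auto
  then have "g x = g y" if "(x, y) \<in> E" for x y
    using that diff_on_edge[OF that, of g] by simp
  from connected_const[OF assms(2), of g, OF this, of x b] show ?thesis
    using assms(3) by simp
qed

text \<open>Existence follows from uniqueness, because an injective linear endomorphism in finite
  dimension is surjective.\<close>

lemma Dirichlet_problem_ex:
  fixes E :: "('v::finite \<times> 'v) set"
  assumes "oriented_graph E" "connected_graph E"
  shows "\<exists>g. g b = 0 \<and> (\<forall>x. x \<noteq> b \<longrightarrow> Laplace E g x = f x)"
proof -
  \<comment> \<open>The row of \<open>b\<close> is replaced by evaluation at \<open>b\<close>, which
    builds the boundary condition into an endomorphism of the full space.\<close>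
  define T :: "real ^ 'v \<Rightarrow> real ^ 'v" where
    "T z = (\<chi> v. if v = b then z $ b else Laplace E (($) z) v)" for z
  have lin: "linear T"
  proof (rule linearI)
    have add: "($) (y + z) = (\<lambda>v. y $ v + z $ v)" and scale: "($) (c *\<^sub>R z) = (\<lambda>v. c * z $ v)"
      for y z :: "real ^ 'v" and c :: real
      by (simp_all add: fun_eq_iff)
    show "T (y + z) = T y + T z" "T (c *\<^sub>R z) = c *\<^sub>R T z" for y z c
      by (simp_all add: T_def vec_eq_iff add scale Laplace_linear)
  qed
  have "inj T"
  proof (rule linear_injective_on_subspace_0[OF lin subspace_UNIV, THEN iffD2], intro ballI impI)
    fix z assume z: "T z = 0"
    have "z $ v = 0" for v
    proof (rule Laplace_Dirichlet_zero[OF assms])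
      show "z $ b = 0" using arg_cong[OF z, of "\<lambda>w. w $ b"] by (simp add: T_def)
      show "Laplace E (($) z) x = 0" if "x \<noteq> b" for x
        using arg_cong[OF z, of "\<lambda>w. w $ x"] that by (simp add: T_def)
    qed
    then show "z = 0" by (simp add: vec_eq_iff)
  qed
  then have "surj T"
    using linear_injective_imp_surjective[OF lin] by blast
  then obtain z where z: "T z = (\<chi> v. if v = b then 0 else f v)"
    by (metis surjD)
  show ?thesis
  proof (intro exI conjI allI impI)
    show "z $ b = 0" using arg_cong[OF z, of "\<lambda>w. w $ b"] by (simp add: T_def)
    show "Laplace E (($) z) x = f x" if "x \<noteq> b" for x
      using arg_cong[OF z, of "\<lambda>w. w $ x"] that by (simp add: T_def)
  qed
qed

lemma Laplace_inv_eqI: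
  fixes E :: "('v::finite \<times> 'v) set"
  assumes "oriented_graph E" "connected_graph E" "f \<in> Omega00 b"
    and "g b = 0" "\<And>x. x \<noteq> b \<Longrightarrow> Laplace E g x = f x"
  shows "Laplace_inv E b f = g"
  unfolding Laplace_inv_def
proof (rule the_inv_into_f_eq)
  show "inj_on (\<lambda>g. (Laplace E g)(b := 0)) (Omega00 b)"
  proof (rule inj_onI)
    fix g h assume gh: "g \<in> Omega00 b" "h \<in> Omega00 b"
      and eq: "(Laplace E g)(b := 0) = (Laplace E h)(b := 0)"
    have "Laplace E g x = Laplace E h x" if "x \<noteq> b" for x
      using fun_cong[OF eq, of x] that by simp
    moreover have "g b - h b = 0"
      using gh by (simp add: Omega00_def)
    ultimately have "g v - h v = 0" for v
      using Laplace_Dirichlet_zero[OF assms(1,2), where b = b and g = "\<lambda>v. g v - h v"]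
      by (simp add: Laplace_linear(3))
    then show "g = h" by (simp add: fun_eq_iff)
  qed
  show "(Laplace E g)(b := 0) = f"
    using assms(3,5) by (auto simp: Omega00_def)
  show "g \<in> Omega00 b" using assms(4) by (simp add: Omega00_def)
qed

lemma Laplace_inv:
  fixes E :: "('v::finite \<times> 'v) set"
  assumes "oriented_graph E" "connected_graph E" "f \<in> Omega00 b"
  shows "Laplace_inv E b f b = 0" "x \<noteq> b \<Longrightarrow> Laplace E (Laplace_inv E b f) x = f x"
proof -
  obtain g where g: "g b = 0" "\<And>x. x \<noteq> b \<Longrightarrow> Laplace E g x = f x"
    using Dirichlet_problem_ex[OF assms(1,2), of b f] by blast
  have "Laplace_inv E b f = g"
    by (rule Laplace_inv_eqI[OF assms]) (use g in auto)
  with g show "Laplace_inv E b f b = 0" "x \<noteq> b \<Longrightarrow> Laplace E (Laplace_inv E b f) x = f x"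
    by auto
qed

text \<open>\<open>Laplace_inv\<close> prescribes the Laplacian only away from \<open>b\<close>; at
  \<open>b\<close> the factor \<open>h b = 0\<close> removes the unknown value.\<close>

lemma inner0_Laplace_inv:
  fixes E :: "('v::finite \<times> 'v) set"
  assumes "oriented_graph E" "connected_graph E" "f \<in> Omega00 b" "h b = 0"
  shows "inner0 h f = (\<Sum>e\<in>E. diff E h e * diff E (Laplace_inv E b f) e)"
proof -
  have "inner0 h f = inner0 h (Laplace E (Laplace_inv E b f))"
    unfolding inner0_def
    by (rule sum.cong[OF refl]) (metis Laplace_inv(2)[OF assms(1-3)] assms(4) mult_eq_0_iff)
  then show ?thesis by (simp add: Green_identity[OF assms(1)])
qed

section \<open>The killed random walk\<close>

lemma nbrs_nonempty:
  assumes "connected_graph E" "x \<noteq> b"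
  shows "nbrs E x \<noteq> {}"
proof -
  have "(x, b) \<in> (E \<union> E\<inverse>)\<^sup>*" using assms(1) by (simp add: connected_graph_def)
  then show ?thesis
    by (cases rule: converse_rtranclE) (use assms(2) in \<open>auto simp: nbrs_def adj_def\<close>)
qed

lemma deg_pos:
  fixes E :: "('v::finite \<times> 'v) set"
  shows "connected_graph E \<Longrightarrow> x \<noteq> b \<Longrightarrow> deg E x > 0"
  using nbrs_nonempty[of E x b] by (simp add: deg_def card_gt_0_iff)

text \<open>The transition operator of the walk killed at \<open>b\<close>. Arrival at
  \<open>b\<close> is not suppressed in the sum, so it has this meaning on functions that vanish at
  \<open>b\<close>.\<close>

definition killed_step :: "('v::finite \<times> 'v) set \<Rightarrow> 'v \<Rightarrow> ('v \<Rightarrow> real) \<Rightarrow> 'v \<Rightarrow> real" where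
  "killed_step E b g x = (if x = b then 0 else (\<Sum>y\<in>nbrs E x. g y) / real (deg E x))"

lemma killed_step_mono: "(\<And>x. f x \<le> g x) \<Longrightarrow> killed_step E b f x \<le> killed_step E b g x"
  by (auto simp: killed_step_def intro!: divide_right_mono sum_mono)

lemma killed_step_sum: "killed_step E b (\<lambda>x. \<Sum>n\<in>A. f n x) x = (\<Sum>n\<in>A. killed_step E b (f n) x)"
  by (simp add: killed_step_def sum_divide_distrib sum.swap[of _ A "nbrs E x"])

lemma killed_step_nonneg: "(\<And>x. 0 \<le> g x) \<Longrightarrow> 0 \<le> killed_step E b g x"
  by (auto simp: killed_step_def intro!: divide_nonneg_nonneg sum_nonneg)

lemma killed_power_nonneg: "(\<And>x. 0 \<le> g x) \<Longrightarrow> 0 \<le> (killed_step E b ^^ n) g x"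
  by (induction n arbitrary: x) (auto intro: killed_step_nonneg)

lemma killed_power_b: "g b = 0 \<Longrightarrow> (killed_step E b ^^ n) g b = 0"
  by (cases n) (auto simp: killed_step_def)

text \<open>The expected hitting time of \<open>b\<close> is a supersolution bounding all partial sums of the Green's function.\<close>

lemma killed_power_summable:
  fixes E :: "('v::finite \<times> 'v) set"
  assumes "oriented_graph E" "connected_graph E"
    and g: "\<And>x. 0 \<le> g x" "\<And>x. g x \<le> 1" "g b = 0"
  shows "summable (\<lambda>n. (killed_step E b ^^ n) g x)"
proof -
  \<comment> \<open>Dividing by the degree turns this Dirichlet problem into
    \<open>u = 1 + killed_step E b u\<close> away from \<open>b\<close>, the equation of the
    expected hitting time.\<close>
  obtain u where u: "u b = 0" "\<And>x. x \<noteq> b \<Longrightarrow> Laplace E u x = real (deg E x)"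
    using Dirichlet_problem_ex[OF assms(1,2), of b "\<lambda>x. real (deg E x)"] by blast
  have ueq: "u x = 1 + killed_step E b u x" if "x \<noteq> b" for x
    using u(2)[OF that] deg_pos[OF assms(2) that] that
    by (simp add: Laplace_deg killed_step_def field_simps)
  \<comment> \<open>Minimum principle: a minimiser away from \<open>b\<close> would satisfy
    \<open>u y \<ge> 1 + u y\<close>, so the minimum is the boundary value 0.\<close>
  define y where "y = arg_min_on u UNIV"
  have y: "u y \<le> u x" for x
    unfolding y_def using arg_min_least[of UNIV x u] by simp
  have "0 \<le> u y"
  proof (cases "y = b")
    case False
    have "killed_step E b (\<lambda>_. u y) y = u y"
      using False deg_pos[OF assms(2) False] nbrs_nonempty[OF assms(2) False]
      by (simp add: killed_step_def deg_def)
    moreover have "killed_step E b (\<lambda>_. u y) y \<le> killed_step E b u y"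
      by (rule killed_step_mono) (rule y)
    ultimately show ?thesis using ueq[OF False] by simp
  qed (simp add: u)
  then have u0: "0 \<le> u x" for x using y[of x] by simp
  \<comment> \<open>After the first term is split off, the remaining partial sum is
    \<open>killed_step\<close> of a shorter one; the bound reproduces itself because
    \<open>g\<close> is at most 1.\<close>
  have bound: "(\<Sum>n<N. (killed_step E b ^^ n) g x) \<le> u x" for N x
  proof (induction N arbitrary: x)
    case (Suc N)
    have "(\<Sum>n<Suc N. (killed_step E b ^^ n) g x) = g x + killed_step E b (\<lambda>x. \<Sum>n<N. (killed_step E b ^^ n) g x) x"
      by (simp add: sum.lessThan_Suc_shift killed_step_sum del: sum.lessThan_Suc)
    also have "\<dots> \<le> u x"
    proof (cases "x = b")
      case False
      have "killed_step E b (\<lambda>x. \<Sum>n<N. (killed_step E b ^^ n) g x) x \<le> killed_step E b u x"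
        by (rule killed_step_mono) (rule Suc.IH)
      then show ?thesis using ueq[OF False] g(2)[of x] by linarith
    qed (simp add: g u killed_step_def)
    finally show ?case .
  qed (simp add: u0)
  show ?thesis
    by (rule bounded_imp_summable[where B = "u x"])
      (auto simp: killed_power_nonneg g bound lessThan_Suc_atMost[symmetric] simp del: sum.lessThan_Suc)
qed

text \<open>The last step is integrated first. Given the past, the mean of \<open>g\<close> at the
  next position is \<open>killed_step E b g\<close> at the current one, so time drops by one while
  the function changes.\<close>

lemma killed_power_walk:
  fixes E :: "('v::finite \<times> 'v) set"
  assumes "connected_graph E" "\<And>x. 0 \<le> g x" "g b = 0"
  shows "(\<integral>\<^sup>+X. ennreal (g (X n)) * indicator {X. \<forall>m\<le>n. X m \<noteq> b} X
      \<partial>Ionescu_Tulcea.C (srw_kernel E v) (\<lambda>_. count_space UNIV) 0 (Suc n) (\<lambda>_. undefined)) =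
    ennreal ((killed_step E b ^^ n) g v)"
proof -
  interpret S: Ionescu_Tulcea "srw_kernel E v" "\<lambda>_. count_space UNIV"
    by (rule Ionescu_Tulcea_srw_kernel)
  note S.C.simps [simp del]
  let ?M = "\<lambda>n::nat. PiM {0..<n} (\<lambda>_. count_space (UNIV :: 'v set))"
  have proj [measurable]: "(\<lambda>X. g (X i)) \<in> borel_measurable (?M n)" if "i < n" for g :: "'v \<Rightarrow> ennreal" and i n
    by (rule measurable_compose[OF measurable_component_singleton]) (use that in auto)
  have meas: "(\<lambda>X. ennreal (g (X n)) * indicator {X. \<forall>m\<le>n. X m \<noteq> b} X) \<in> borel_measurable (?M (Suc n))" for g n
  proof -
    \<comment> \<open>Avoiding \<open>b\<close> up to time \<open>n\<close> is written as a finite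
      product of functions of single coordinates.\<close>
    have "(indicator {X. \<forall>m\<le>n. X m \<noteq> b} :: _ \<Rightarrow> ennreal) = (\<lambda>X. \<Prod>m\<le>n. indicator (- {b}) (X m))"
      by (auto simp: fun_eq_iff indicator_def prod.If_cases)
    moreover have "(\<lambda>X. \<Prod>m\<le>n. indicator (- {b}) (X m) :: ennreal) \<in> borel_measurable (?M (Suc n))"
      by (rule borel_measurable_prod_ennreal) (auto intro!: proj[where g = "indicator (- {b})"])
    ultimately show ?thesis
      using proj[of n "Suc n" "\<lambda>y. ennreal (g y)"] by (intro borel_measurable_times_ennreal) auto
  qed
  have und: "(\<lambda>_. undefined) \<in> space (?M 0)" by (simp add: space_PiM)
  show ?thesis
    using assms(2,3)
  proof (induction n arbitrary: g)
    case 0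
    \<comment> \<open>Kernel 0 places the starting point, so \<open>Suc n\<close> kernels describe
      the positions at times 0 to \<open>n\<close>.\<close>
    have C0: "S.C 0 (Suc 0) (\<lambda>_. undefined) = S.eP 0 (\<lambda>_. undefined)"
      unfolding S.C.simps add_0 by (rule bind_return[OF S.measurable_eP und])
    show ?case
      unfolding C0 S.nn_integral_eP[OF und meas[of g 0]]
      using 0 by (auto simp: srw_kernel_def indicator_def)
  next
    case (Suc n)
    have eP: "S.eP (Suc n) \<in> S.C 0 (Suc n) (\<lambda>_. undefined) \<rightarrow>\<^sub>M subprob_algebra (?M (Suc (Suc n)))"
      using S.measurable_eP[of "Suc n"] by (simp add: measurable_cong_sets[OF S.sets_C[OF und, of "Suc n"] refl])
    let ?I = "\<lambda>n X. indicator {X :: nat \<Rightarrow> 'v. \<forall>m\<le>n. X m \<noteq> b} X :: ennreal"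
    have "(\<integral>\<^sup>+X. ennreal (g (X (Suc n))) * ?I (Suc n) X \<partial>S.C 0 (Suc (Suc n)) (\<lambda>_. undefined)) =
      (\<integral>\<^sup>+X. (\<integral>\<^sup>+Y. ennreal (g (Y (Suc n))) * ?I (Suc n) Y \<partial>S.eP (Suc n) X) \<partial>S.C 0 (Suc n) (\<lambda>_. undefined))"
      using nn_integral_bind[OF meas[of g "Suc n"] eP] by (simp add: S.C.simps(2)[of 0 "Suc n"])
    also have "\<dots> = (\<integral>\<^sup>+X. ennreal (killed_step E b g (X n)) * ?I n X \<partial>S.C 0 (Suc n) (\<lambda>_. undefined))"
    proof (rule nn_integral_cong)
      fix X assume "X \<in> space (S.C 0 (Suc n) (\<lambda>_. undefined))"
      then have X: "X \<in> space (?M (Suc n))" using und by (simp add: S.space_C)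
      have "(\<integral>\<^sup>+Y. ennreal (g (Y (Suc n))) * ?I (Suc n) Y \<partial>S.eP (Suc n) X) =
        (\<integral>\<^sup>+y. ennreal (g y) * ?I (Suc n) (X(Suc n := y)) \<partial>srw_kernel E v (Suc n) X)"
        using X meas[of g "Suc n"] by (subst S.nn_integral_eP) simp_all
      also have "\<dots> = (\<integral>\<^sup>+y. ennreal (g y) * ?I n X \<partial>measure_pmf (pmf_of_set (nbrs E (X n))))"
      proof -
        have "ennreal (g y) * ?I (Suc n) (X(Suc n := y)) = ennreal (g y) * ?I n X" for y
          using Suc.prems(2) by (cases "y = b") (auto simp: indicator_def le_Suc_eq)
        then show ?thesis
          by (simp only: srw_kernel_def nat.case)
      qed
      also have "\<dots> = (\<integral>\<^sup>+y. ennreal (g y) \<partial>measure_pmf (pmf_of_set (nbrs E (X n)))) * ?I n X"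
        by (simp add: nn_integral_multc)
      also have "\<dots> = ennreal (killed_step E b g (X n)) * ?I n X"
      proof (cases "X n = b")
        case False
        have ne: "nbrs E (X n) \<noteq> {}" using nbrs_nonempty[OF assms(1) False] .
        then have "(\<integral>\<^sup>+y. ennreal (g y) \<partial>measure_pmf (pmf_of_set (nbrs E (X n)))) = ennreal (killed_step E b g (X n))"
          using False Suc.prems(1) deg_pos[OF assms(1) False]
          by (simp add: nn_integral_pmf_of_set killed_step_def deg_def sum_ennreal divide_ennreal sum_nonneg
              ennreal_of_nat_eq_real_of_nat)
        then show ?thesis by simp
      qed (auto simp: indicator_def)
      finally show "(\<integral>\<^sup>+Y. ennreal (g (Y (Suc n))) * ?I (Suc n) Y \<partial>S.eP (Suc n) X) =
        ennreal (killed_step E b g (X n)) * ?I n X" .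
    qed
    also have "\<dots> = ennreal ((killed_step E b ^^ n) (killed_step E b g) v)"
      by (rule Suc.IH) (auto simp: killed_step_nonneg Suc.prems killed_step_def[where x = b])
    finally show ?case by (simp add: funpow_Suc_right del: funpow.simps)
  qed
qed

text \<open>The point mass at \<open>v'\<close>, set to zero for \<open>v' = b\<close>, in
  accordance with killing at \<open>b\<close>.\<close>

definition killed_point :: "'v \<Rightarrow> 'v \<Rightarrow> 'v \<Rightarrow> real" where
  "killed_point b v' x = of_bool (x = v' \<and> x \<noteq> b)"

text \<open>The visits are counted time by time. Each event depends on finitely many coordinates, so
  its probability is read off a finite-dimensional marginal; monotone convergence sums them.\<close>

lemma nn_integral_killed_visits:
  fixes E :: "('v::finite \<times> 'v) set"
  assumes "connected_graph E"
  shows "(\<integral>\<^sup>+X. killed_visits b v' X \<partial>srw_law E v) = (\<Sum>n. ennreal ((killed_step E b ^^ n) (killed_point b v') v))"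
proof -
  interpret S: Ionescu_Tulcea "srw_kernel E v" "\<lambda>_. count_space UNIV"
    by (rule Ionescu_Tulcea_srw_kernel)
  note S.C.simps [simp del]
  let ?M = "\<lambda>n::nat. PiM {0..<n} (\<lambda>_. count_space (UNIV :: 'v set))"
  define A where "A n = {X :: nat \<Rightarrow> 'v. X n = v' \<and> (\<forall>m\<le>n. X m \<noteq> b)}" for n
  have law: "srw_law E v = S.PF.lim" by (simp add: srw_law_def)
  have sA: "A n \<inter> space (?M (Suc n)) \<in> sets (?M (Suc n))" for n
  proof -
    have *: "{X \<in> space (?M (Suc n)). X m \<in> B} \<in> sets (?M (Suc n))" if "m \<le> n" for m B
      using measurable_sets[OF measurable_component_singleton[of m "{0..<Suc n}" "\<lambda>_. count_space UNIV"], of B] that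
      by (simp add: vimage_def Int_def conj_commute)
    have "A n \<inter> space (?M (Suc n)) =
      {X \<in> space (?M (Suc n)). X n \<in> {v'}} \<inter> (\<Inter>m\<in>{..n}. {X \<in> space (?M (Suc n)). X m \<in> - {b}})"
      by (auto simp: A_def)
    also have "\<dots> \<in> sets (?M (Suc n))"
      by (intro sets.Int sets.finite_INT *) auto
    finally show ?thesis .
  qed
  \<comment> \<open>\<open>A n\<close> is a cylinder set over the times 0 to \<open>n\<close>, the
    form in which the projective limit is evaluated.\<close>
  have emb: "S.PF.emb UNIV {0..<Suc n} (A n \<inter> space (?M (Suc n))) = A n" for n
    by (auto simp: prod_emb_def space_PiM A_def)
  have A_sets: "A n \<in> sets (srw_law E v)" for n
  proof -
    have "S.PF.emb UNIV {0..<Suc n} (A n \<inter> space (?M (Suc n))) \<in> sets (PiM UNIV (\<lambda>_. count_space (UNIV :: 'v set)))"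
      by (rule measurable_prod_emb[OF _ sA]) simp
    then show ?thesis unfolding emb by (simp add: law)
  qed
  have und: "(\<lambda>_. undefined) \<in> space (?M 0)" by (simp add: space_PiM)
  have A_emeasure: "emeasure (srw_law E v) (A n) = ennreal ((killed_step E b ^^ n) (killed_point b v') v)" for n
  proof -
    have "emeasure (srw_law E v) (A n) = emeasure S.PF.lim (S.PF.emb UNIV {0..<Suc n} (A n \<inter> space (?M (Suc n))))"
      by (simp only: emb law)
    also have "\<dots> = emeasure (S.CI {0..<Suc n}) (A n \<inter> space (?M (Suc n)))"
      by (rule S.lim[OF _ sA]) simp
    also have "\<dots> = emeasure (S.C 0 (Suc n) (\<lambda>_. undefined)) (S.PF.emb {0..<Suc n} {0..<Suc n} (A n \<inter> space (?M (Suc n))))"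
      by (rule S.emeasure_CI[OF subset_refl sA])
    also have "S.PF.emb {0..<Suc n} {0..<Suc n} (A n \<inter> space (?M (Suc n))) = A n \<inter> space (?M (Suc n))"
      by (rule prod_emb_id) (auto simp: space_PiM)
    also have "emeasure (S.C 0 (Suc n) (\<lambda>_. undefined)) (A n \<inter> space (?M (Suc n))) =
      (\<integral>\<^sup>+X. indicator (A n \<inter> space (?M (Suc n))) X \<partial>S.C 0 (Suc n) (\<lambda>_. undefined))"
      using sA S.sets_C[OF und, of "Suc n"] by (subst nn_integral_indicator) simp_all
    also have "\<dots> = (\<integral>\<^sup>+X. ennreal (killed_point b v' (X n)) * indicator {X. \<forall>m\<le>n. X m \<noteq> b} X \<partial>S.C 0 (Suc n) (\<lambda>_. undefined))"
      using S.space_C[OF und, of "Suc n"]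
      by (intro nn_integral_cong) (auto simp: indicator_def A_def killed_point_def)
    also have "\<dots> = ennreal ((killed_step E b ^^ n) (killed_point b v') v)"
      by (rule killed_power_walk[OF assms(1)]) (auto simp: killed_point_def)
    finally show ?thesis .
  qed
  have "killed_visits b v' X = (\<Sum>n. indicator (A n) X)" for X
  proof -
    have "killed_visits b v' X = (\<integral>\<^sup>+n. indicator {n. X n = v' \<and> (\<forall>m\<le>n. X m \<noteq> b)} n \<partial>count_space UNIV)"
      by (simp add: killed_visits_def)
    also have "\<dots> = (\<Sum>n. indicator {n. X n = v' \<and> (\<forall>m\<le>n. X m \<noteq> b)} n)"
      by (rule nn_integral_count_space_nat)
    finally show ?thesis by (simp add: A_def indicator_def)
  qed
  then have "(\<integral>\<^sup>+X. killed_visits b v' X \<partial>srw_law E v) = (\<Sum>n. \<integral>\<^sup>+X. indicator (A n) X \<partial>srw_law E v)"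
    using A_sets by (simp add: nn_integral_suminf)
  then show ?thesis
    using A_sets A_emeasure by simp
qed

section \<open>Green's function as the kernel of the inverse Laplacian\<close>

lemma Green_suminf:
  fixes E :: "('v::finite \<times> 'v) set"
  assumes "oriented_graph E" "connected_graph E"
  shows "Green E b v v' = (\<Sum>n. (killed_step E b ^^ n) (killed_point b v') v)"
    and "summable (\<lambda>n. (killed_step E b ^^ n) (killed_point b v') v)"
proof -
  have nn: "0 \<le> (killed_step E b ^^ n) (killed_point b v') v" for n
    by (rule killed_power_nonneg) (simp add: killed_point_def)
  show s: "summable (\<lambda>n. (killed_step E b ^^ n) (killed_point b v') v)"
    by (rule killed_power_summable[OF assms(1,2)]) (auto simp: killed_point_def)
  show "Green E b v v' = (\<Sum>n. (killed_step E b ^^ n) (killed_point b v') v)"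
    \<comment> \<open>Summability makes the extended non-negative sum finite, so
      \<open>enn2real\<close> returns its true value.\<close>
    unfolding Green_def nn_integral_killed_visits[OF assms(2)] 
    using nn s by (simp add: suminf_ennreal2 suminf_nonneg)
qed

text \<open>First-step analysis: time 0 contributes the point mass, and the later times give the
  average of the Green's function over the neighbours.\<close>

lemma Green_equation:
  fixes E :: "('v::finite \<times> 'v) set"
  assumes "oriented_graph E" "connected_graph E"
  shows "Green E b b v' = 0"
    and "v \<noteq> b \<Longrightarrow> Laplace E (\<lambda>v. Green E b v v') v = of_bool (v = v') * real (deg E v)"
proof -
  define g where "g = killed_point b v'"
  define a where "a n = (killed_step E b ^^ n) g" for n
  have G: "Green E b v v' = (\<Sum>n. a n v)" and s: "summable (\<lambda>n. a n v)" for v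
    using Green_suminf[OF assms] by (simp_all add: g_def a_def)
  show "Green E b b v' = 0"
    unfolding G by (simp add: a_def killed_power_b g_def killed_point_def)
  show "Laplace E (\<lambda>v. Green E b v v') v = of_bool (v = v') * real (deg E v)" if v: "v \<noteq> b"
  proof -
    have "Green E b v v' = a 0 v + (\<Sum>n. a (Suc n) v)"
      unfolding G using suminf_split_head[OF s] by simp
    also have "(\<Sum>n. a (Suc n) v) = (\<Sum>y\<in>nbrs E v. Green E b y v') / real (deg E v)"
    proof -
      have "(\<Sum>n. a (Suc n) v) = (\<Sum>n. (\<Sum>y\<in>nbrs E v. a n y) / real (deg E v))"
        using v by (simp add: a_def killed_step_def)
      also have "\<dots> = (\<Sum>n. \<Sum>y\<in>nbrs E v. a n y) / real (deg E v)"
        by (rule suminf_divide) (intro summable_sum s)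
      also have "(\<Sum>n. \<Sum>y\<in>nbrs E v. a n y) = (\<Sum>y\<in>nbrs E v. Green E b y v')"
        unfolding G by (rule suminf_sum) (rule s)
      finally show ?thesis .
    qed
    also have "a 0 v = of_bool (v = v')"
      using v by (simp add: a_def g_def killed_point_def)
    finally show ?thesis
      using deg_pos[OF assms(2) v] by (simp add: Laplace_deg field_simps)
  qed
qed

text \<open>By the Green equation the column of \<open>v'\<close> has Laplacian
  \<open>deg E v'\<close> times the point mass at \<open>v'\<close> away from \<open>b\<close>;
  dividing by this degree and superposing the columns solves the Dirichlet problem for
  \<open>f\<close>.\<close>

lemma Laplace_inv_Green:
  fixes E :: "('v::finite \<times> 'v) set"
  assumes "oriented_graph E" "connected_graph E" "f \<in> Omega00 b"
  shows "Laplace_inv E b f = (\<lambda>v. \<Sum>v'\<in>UNIV. f v' * (Green E b v v' / real (deg E v')))"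
proof (rule Laplace_inv_eqI[OF assms])
  show "(\<Sum>v'\<in>UNIV. f v' * (Green E b b v' / real (deg E v'))) = 0"
    by (simp add: Green_equation(1)[OF assms(1,2)])
  fix x assume x: "x \<noteq> b"
  have "Laplace E (\<lambda>v. \<Sum>v'\<in>UNIV. f v' * (Green E b v v' / real (deg E v'))) x =
    (\<Sum>v'\<in>UNIV. f v' / real (deg E v') * Laplace E (\<lambda>v. Green E b v v') x)"
    by (simp add: Laplace_deg sum_distrib_left sum_subtractf right_diff_distrib
        sum.swap[of _ UNIV "nbrs E x"] mult_ac)
  also have "\<dots> = (\<Sum>v'\<in>UNIV. if v' = x then f x else 0)"
    using deg_pos[OF assms(2) x]
    by (intro sum.cong) (auto simp: Green_equation(2)[OF assms(1,2) x])
  finally show "Laplace E (\<lambda>v. \<Sum>v'\<in>UNIV. f v' * (Green E b v v' / real (deg E v'))) x = f x"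
    by simp
qed

lemma inner0_Laplace_inv_Green:
  fixes E :: "('v::finite \<times> 'v) set"
  assumes "oriented_graph E" "connected_graph E" "f \<in> Omega00 b"
  shows "inner0 (Laplace_inv E b f) f =
    (\<Sum>v\<in>UNIV. \<Sum>v'\<in>UNIV. f v * f v' * (Green E b v v' / real (deg E v')))"
  by (simp add: inner0_def Laplace_inv_Green[OF assms] sum_distrib_left sum_distrib_right mult_ac)

section \<open>Spin weights\<close>

definition weight_term :: "(int \<Rightarrow> ereal) \<Rightarrow> nat \<Rightarrow> real" where
  "weight_term \<V> k = 2 * exp_neg (\<V> (int (Suc k)))"

text \<open>The termwise derivative of the weight. As an explicit series it can be identified both
  with a derivative and with the Fourier series of a moment.\<close>

definition spin_weight' :: "(int \<Rightarrow> ereal) \<Rightarrow> real \<Rightarrow> real" where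
  "spin_weight' \<V> \<alpha> = (\<Sum>k. - (weight_term \<V> k * real (Suc k) * sin (real (Suc k) * \<alpha>)))"

definition spin_weight'' :: "(int \<Rightarrow> ereal) \<Rightarrow> real \<Rightarrow> real" where
  "spin_weight'' \<V> \<alpha> = (\<Sum>k. - (weight_term \<V> k * (real (Suc k))\<^sup>2 * cos (real (Suc k) * \<alpha>)))"

lemma exp_neg_nonneg: "x \<noteq> -\<infinity> \<Longrightarrow> 0 \<le> exp_neg x"
  by (cases x) (auto simp: exp_neg_def)

lemma exp_neg_add: "x \<noteq> -\<infinity> \<Longrightarrow> y \<noteq> -\<infinity> \<Longrightarrow> exp_neg (x + y) = exp_neg x * exp_neg y"
  by (cases x; cases y) (auto simp: exp_neg_def exp_add[symmetric])

lemma exp_neg_sum: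
  assumes "finite A" "\<And>x. x \<in> A \<Longrightarrow> f x \<noteq> -\<infinity>"
  shows "exp_neg (sum f A) = (\<Prod>x\<in>A. exp_neg (f x))"
proof -
  \<comment> \<open>The induction must carry along that partial sums avoid minus infinity, since
    \<open>exp_neg\<close> is multiplicative only then.\<close>
  have "sum f A \<noteq> -\<infinity> \<and> exp_neg (sum f A) = (\<Prod>x\<in>A. exp_neg (f x))"
    using assms
  proof (induction A rule: finite_induct)
    case empty
    show ?case by (simp add: exp_neg_def zero_ereal_def)
  qed (auto simp: exp_neg_add)
  then show ?thesis by simp
qed

lemma summable_abs_comparison:
  fixes f g :: "nat \<Rightarrow> real"
  shows "summable g \<Longrightarrow> (\<And>k. \<bar>f k\<bar> \<le> g k) \<Longrightarrow> summable f"
  by (rule summable_comparison_test[of f g]) auto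

text \<open>Pairing \<open>k\<close> with \<open>-k\<close> is what turns exponential sums into the
  cosine and sine series of the weights.\<close>

lemma integral_int_halves:
  fixes q :: "int \<Rightarrow> 'a::{banach, second_countable_topology}"
  assumes "integrable (count_space UNIV) q"
  shows "(\<integral>k. q k \<partial>count_space UNIV) = q 0 + (\<Sum>k. q (int (Suc k)) + q (- int (Suc k)))"
proof -
  let ?P = "range (\<lambda>k. int (Suc k))" and ?N = "range (\<lambda>k. - int (Suc k))"
  have bij: "bij_betw (\<lambda>k. int (Suc k)) UNIV ?P" "bij_betw (\<lambda>k. - int (Suc k)) UNIV ?N"
    by (auto intro!: inj_on_imp_bij_betw inj_onI)
  have sub: "integrable (count_space A) q" for A
    using abs_summable_on_subset[of q UNIV A] assms by (simp add: abs_summable_on_def)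
  have P: "(\<lambda>k. q (int (Suc k))) sums infsetsum q ?P"
    using sums_integral_count_space_nat[of "\<lambda>k. q (int (Suc k))"] sub[of ?P]
      integrable_bij_count_space[OF bij(1), of q] integral_bij_count_space[OF bij(1), of q]
    by (simp add: infsetsum_def)
  have N: "(\<lambda>k. q (- int (Suc k))) sums infsetsum q ?N"
    using sums_integral_count_space_nat[of "\<lambda>k. q (- int (Suc k))"] sub[of ?N]
      integrable_bij_count_space[OF bij(2), of q] integral_bij_count_space[OF bij(2), of q]
    by (simp add: infsetsum_def)
  have U: "UNIV = {0} \<union> (?P \<union> ?N)"
  proof (intro equalityI subsetI)
    fix k :: int
    show "k \<in> {0} \<union> (?P \<union> ?N)"
    proof (cases "k = 0 \<or> k > 0")
      case True
      then show ?thesis by (auto simp: image_iff intro!: exI[of _ "nat k - 1"])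
    next
      case False
      then have "k = - int (Suc (nat (- k) - 1))" by simp
      then show ?thesis by blast
    qed
  qed auto
  have "infsetsum q UNIV = infsetsum q {0} + infsetsum q (?P \<union> ?N)"
    by (subst U, rule infsetsum_Un_disjoint) (auto simp: abs_summable_on_def sub)
  also have "infsetsum q (?P \<union> ?N) = infsetsum q ?P + infsetsum q ?N"
    by (rule infsetsum_Un_disjoint) (auto simp: abs_summable_on_def sub)
  also have "\<dots> = (\<Sum>k. q (int (Suc k)) + q (- int (Suc k)))"
    using sums_unique[OF sums_add[OF P N]] by simp
  finally show ?thesis
    by (simp add: infsetsum_def lebesgue_integral_count_space_finite)
qed

section \<open>Moments of a height function potential\<close>

locale height_potential =
  fixes \<V> :: "int \<Rightarrow> ereal"
  assumes potential: "height_function_potential \<V>"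
begin

abbreviation "w \<equiv> spin_weight \<V>"
abbreviation "w' \<equiv> spin_weight' \<V>"
abbreviation "w'' \<equiv> spin_weight'' \<V>"
abbreviation "p k \<equiv> exp_neg (\<V> k)"

lemma potential_not_minus_infinity: "\<V> k \<noteq> -\<infinity>"
  and potential_even: "\<V> (- k) = \<V> k"
  and weight_pos: "w \<alpha> > 0"
  using potential by (auto simp: height_function_potential_def)

lemma p_nonneg: "0 \<le> p k"
  by (rule exp_neg_nonneg[OF potential_not_minus_infinity])

lemma integrable_p2: "integrable (count_space UNIV) (\<lambda>k. (real_of_int k)\<^sup>2 * p k)"
proof -
  have "(\<lambda>k. norm ((real_of_int k)\<^sup>2 * p k)) summable_on UNIV"
    using potential by (simp add: height_function_potential_def abs_mult p_nonneg)
  then show ?thesis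
    unfolding abs_summable_equivalent[symmetric] abs_summable_on_def[symmetric] .
qed

text \<open>The second moment dominates \<open>p k\<close> for all \<open>k\<close> other than 0;
  the indicator term covers the remaining point.\<close>

lemma integrable_p0: "integrable (count_space UNIV) p"
proof -
  have "integrable (count_space UNIV) (\<lambda>k. (real_of_int k)\<^sup>2 * p k + p 0 * indicator {0} k)"
    using integrable_p2 by (intro Bochner_Integration.integrable_add integrable_mult_right) auto
  then show ?thesis
  proof (rule Bochner_Integration.integrable_bound)
    show "AE k in count_space UNIV. norm (p k) \<le> norm ((real_of_int k)\<^sup>2 * p k + p 0 * indicator {0} k)"
    proof (intro AE_I2)
      fix k :: int
      have "p k \<le> (real_of_int k)\<^sup>2 * p k" if "k \<noteq> 0"
      proof -
        have "1 \<le> \<bar>real_of_int k\<bar>" using that by linarith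
        then have "1 \<le> (real_of_int k)\<^sup>2" using one_le_power[of "\<bar>real_of_int k\<bar>" 2] by simp
        then show ?thesis using mult_right_mono[OF _ p_nonneg[of k]] by fastforce
      qed
      then show "norm (p k) \<le> norm ((real_of_int k)\<^sup>2 * p k + p 0 * indicator {0} k)"
        by (cases "k = 0") (auto simp: p_nonneg)
    qed
  qed auto
qed

lemma integrable_p1: "integrable (count_space UNIV) (\<lambda>k. real_of_int k * p k)"
proof (rule Bochner_Integration.integrable_bound[OF integrable_p2])
  show "AE k in count_space UNIV. norm (real_of_int k * p k) \<le> norm ((real_of_int k)\<^sup>2 * p k)"
  proof (intro AE_I2)
    fix k :: int
    have "\<bar>k\<bar> * 1 \<le> \<bar>k\<bar> * \<bar>k\<bar>"
      by (cases "k = 0") (simp, intro mult_left_mono, auto)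
    then have "\<bar>k\<bar> \<le> k\<^sup>2" by (simp add: power2_eq_square)
    then have "\<bar>real_of_int k\<bar> \<le> (real_of_int k)\<^sup>2"
      by (metis of_int_abs of_int_le_iff of_int_power)
    then show "norm (real_of_int k * p k) \<le> norm ((real_of_int k)\<^sup>2 * p k)"
      by (simp add: abs_mult p_nonneg mult_right_mono)
  qed
qed auto

lemma summable_half:
  fixes q :: "int \<Rightarrow> real"
  assumes "integrable (count_space UNIV) q"
  shows "summable (\<lambda>k. q (int (Suc k)))"
proof -
  have inj: "inj (\<lambda>k. int (Suc k))" by (auto intro: injI)
  have "integrable (count_space (range (\<lambda>k. int (Suc k)))) q"
    using abs_summable_on_subset[of q UNIV] assms by (simp add: abs_summable_on_def)
  then have "integrable (count_space UNIV) (\<lambda>k. q (int (Suc k)))"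
    using integrable_bij_count_space[OF inj_on_imp_bij_betw[OF inj], of q] by simp
  then show ?thesis
    using sums_integral_count_space_nat sums_summable by blast
qed

lemma summable_weight: 
  "summable (weight_term \<V>)" 
  "summable (\<lambda>k. weight_term \<V> k * real (Suc k))" 
  "summable (\<lambda>k. weight_term \<V> k * (real (Suc k))\<^sup>2)"
  using summable_mult[OF summable_half[OF integrable_p0], of 2]
    summable_mult[OF summable_half[OF integrable_p1], of 2]
    summable_mult[OF summable_half[OF integrable_p2], of 2]
  by (simp_all add: weight_term_def[abs_def] mult_ac)

lemma weight_term_nonneg: "0 \<le> weight_term \<V> k"
  by (simp add: weight_term_def p_nonneg)

section \<open>Derivatives and bounds of the spin weight\<close>

lemma summable_trig:
  "summable (\<lambda>k. weight_term \<V> k * cos (real (Suc k) * \<alpha>))"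
  "summable (\<lambda>k. - (weight_term \<V> k * real (Suc k) * sin (real (Suc k) * \<alpha>)))"
  "summable (\<lambda>k. - (weight_term \<V> k * (real (Suc k))\<^sup>2 * cos (real (Suc k) * \<alpha>)))"
  by (rule summable_abs_comparison[OF summable_weight(1)] summable_abs_comparison[OF summable_weight(2)]
      summable_abs_comparison[OF summable_weight(3)],
      simp add: abs_mult weight_term_nonneg mult_left_le del: of_nat_Suc)+

lemma spin_weight_alt: "w \<alpha> = p 0 + (\<Sum>k. weight_term \<V> k * cos (real (Suc k) * \<alpha>))"
  by (simp add: spin_weight_def weight_term_def)

text \<open>The differentiated series converges uniformly, with the first-moment coefficients as
  majorant, so differentiation may be carried out term by term.\<close>

lemma spin_weight_deriv: "(w has_real_derivative w' \<alpha>) (at \<alpha>)"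
proof -
  let ?f = "\<lambda>k \<alpha>. weight_term \<V> k * cos (real (Suc k) * \<alpha>)"
  have "((\<lambda>\<alpha>. \<Sum>k. ?f k \<alpha>) has_field_derivative w' \<alpha>) (at \<alpha>)"
    unfolding spin_weight'_def
  proof (rule has_field_derivative_series'(2)[where S = UNIV and ?x0.0 = 0 and f = ?f
        and f' = "\<lambda>k x. - (weight_term \<V> k * real (Suc k) * sin (real (Suc k) * x))"
        and x = \<alpha>])
    show "(?f k has_field_derivative - (weight_term \<V> k * real (Suc k) * sin (real (Suc k) * x))) (at x within UNIV)" for k x
      by (auto intro!: derivative_eq_intros)
    show "uniformly_convergent_on UNIV (\<lambda>n x. \<Sum>i<n. - (weight_term \<V> i * real (Suc i) * sin (real (Suc i) * x)))"
      by (rule Weierstrass_m_test'[OF _ summable_weight(2)])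
        (simp add: abs_mult weight_term_nonneg mult_left_le del: of_nat_Suc)
    show "summable (\<lambda>k. ?f k 0)" by (rule summable_trig)
  qed auto
  then show ?thesis
    unfolding spin_weight_alt[abs_def] using DERIV_add[OF DERIV_const, of _ _ \<alpha> _ "p 0"] by fastforce
qed

text \<open>The same argument one order higher, where finiteness of the second moment supplies the
  majorant.\<close>

lemma spin_weight'_deriv: "(w' has_real_derivative w'' \<alpha>) (at \<alpha>)"
proof -
  let ?f = "\<lambda>k \<alpha>. - (weight_term \<V> k * real (Suc k) * sin (real (Suc k) * \<alpha>))"
  show ?thesis
    unfolding spin_weight''_def spin_weight'_def[abs_def]
  proof (rule has_field_derivative_series'(2)[where S = UNIV and ?x0.0 = 0 and f = ?f
        and f' = "\<lambda>k x. - (weight_term \<V> k * (real (Suc k))\<^sup>2 * cos (real (Suc k) * x))"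
        and x = \<alpha>])
    show "(?f k has_field_derivative - (weight_term \<V> k * (real (Suc k))\<^sup>2 * cos (real (Suc k) * x))) (at x within UNIV)" for k x
      by (auto intro!: derivative_eq_intros simp: power2_eq_square)
    show "uniformly_convergent_on UNIV (\<lambda>n x. \<Sum>i<n. - (weight_term \<V> i * (real (Suc i))\<^sup>2 * cos (real (Suc i) * x)))"
      by (rule Weierstrass_m_test'[OF _ summable_weight(3)])
        (simp add: abs_mult weight_term_nonneg mult_left_le del: of_nat_Suc)
    show "summable (\<lambda>k. ?f k 0)" by (rule summable_trig)
  qed auto
qed

text \<open>Separates the square of the logarithmic derivative from the ratio \<open>w'' / w\<close>
  that second moments produce.\<close>

lemma dual_potential_deriv2:
  "deriv (deriv (dual_spin_potential \<V>)) \<alpha> = (w' \<alpha> / w \<alpha>)\<^sup>2 - w'' \<alpha> / w \<alpha>"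
proof -
  have "(dual_spin_potential \<V> has_real_derivative - (w' \<alpha> / w \<alpha>)) (at \<alpha>)" for \<alpha>
    unfolding dual_spin_potential_def[abs_def]
    using weight_pos[of \<alpha>] by (auto intro!: derivative_eq_intros spin_weight_deriv simp: field_simps)
  then have "deriv (dual_spin_potential \<V>) = (\<lambda>\<alpha>. - (w' \<alpha> / w \<alpha>))"
    by (auto intro!: DERIV_imp_deriv)
  moreover have "((\<lambda>\<alpha>. - (w' \<alpha> / w \<alpha>)) has_real_derivative (w' \<alpha> / w \<alpha>)\<^sup>2 - w'' \<alpha> / w \<alpha>) (at \<alpha>)"
    using weight_pos[of \<alpha>]
    by (auto intro!: derivative_eq_intros spin_weight_deriv spin_weight'_deriv
        simp: power2_eq_square divide_simps)
  ultimately show ?thesis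
    by (simp add: DERIV_imp_deriv)
qed

lemma borel_w [measurable]: "w \<in> borel_measurable borel" "w' \<in> borel_measurable borel"
    "w'' \<in> borel_measurable borel"
  unfolding spin_weight_def[abs_def] spin_weight'_def[abs_def] spin_weight''_def[abs_def]
  by measurable

text \<open>The lower bound is the minimum over a compact interval containing all values of
  \<open>angle\<close>; the upper bounds are the absolute sums of the series.\<close>

lemma weight_bounds:
  obtains c B where "0 < c" "\<And>\<alpha>. \<bar>\<alpha>\<bar> \<le> pi \<Longrightarrow> c \<le> w \<alpha>" "\<And>\<alpha>. \<bar>w \<alpha>\<bar> \<le> B" "\<And>\<alpha>. \<bar>w' \<alpha>\<bar> \<le> B" "\<And>\<alpha>. \<bar>w'' \<alpha>\<bar> \<le> B"
proof -
  have cont: "continuous_on {-pi..pi} w"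
    using spin_weight_deriv DERIV_continuous_on has_field_derivative_at_within by blast
  obtain x where "\<forall>y\<in>{-pi..pi}. w x \<le> w y"
    using continuous_attains_inf[OF compact_Icc _ cont] by auto
  then have x: "\<And>y. y \<in> {-pi..pi} \<Longrightarrow> w x \<le> w y" by blast
  have bd: "\<bar>\<Sum>k. f k\<bar> \<le> (\<Sum>k. g k)" if "summable g" "\<And>k. \<bar>f k\<bar> \<le> g k" for f g :: "nat \<Rightarrow> real"
  proof -
    have "summable (\<lambda>k. \<bar>f k\<bar>)"
      using that by (intro summable_abs_comparison[of g "\<lambda>k. \<bar>f k\<bar>"]) auto
    then have "\<bar>\<Sum>k. f k\<bar> \<le> (\<Sum>k. \<bar>f k\<bar>)" by (rule summable_rabs)
    also have "\<dots> \<le> (\<Sum>k. g k)" using that \<open>summable (\<lambda>k. \<bar>f k\<bar>)\<close> by (intro suminf_le) auto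
    finally show ?thesis .
  qed
  let ?B = "\<lambda>f. \<Sum>k. weight_term \<V> k * f k"
  let ?B0 = "\<Sum>k. weight_term \<V> k" and ?B1 = "?B (\<lambda>k. real (Suc k))" and ?B2 = "?B (\<lambda>k. (real (Suc k))\<^sup>2)"
  have b0: "\<bar>w \<alpha>\<bar> \<le> p 0 + ?B0" for \<alpha>
  proof -
    have "\<bar>\<Sum>k. weight_term \<V> k * cos (real (Suc k) * \<alpha>)\<bar> \<le> ?B0"
      by (rule bd[OF summable_weight(1)]) (simp add: abs_mult weight_term_nonneg mult_left_le del: of_nat_Suc)
    then show ?thesis
      unfolding spin_weight_alt using p_nonneg[of 0] by linarith
  qed
  have b1: "\<bar>w' \<alpha>\<bar> \<le> ?B1" for \<alpha>
    unfolding spin_weight'_def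
    by (rule bd[OF summable_weight(2)]) (simp add: abs_mult weight_term_nonneg mult_left_le del: of_nat_Suc)
  have b2: "\<bar>w'' \<alpha>\<bar> \<le> ?B2" for \<alpha>
    unfolding spin_weight''_def
    by (rule bd[OF summable_weight(3)]) (simp add: abs_mult weight_term_nonneg mult_left_le del: of_nat_Suc)
  show ?thesis
  proof (rule that[of "w x" "max (p 0 + ?B0) (max ?B1 ?B2)"])
    show "w x \<le> w \<alpha>" if "\<bar>\<alpha>\<bar> \<le> pi" for \<alpha>
      using that by (intro x) auto
  qed (use weight_pos b0 b1 b2 in \<open>auto simp: le_max_iff_disj\<close>)
qed

text \<open>Each factor \<open>k\<close> corresponds to \<open>-i\<close> times a derivative in the
  angle. Evenness of the potential leaves cosines for the even moments and sines for the odd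
  one.\<close>

lemma weight_fourier:
  "(\<integral>k. complex_of_real (p k) * cis \<alpha> powi k \<partial>count_space UNIV) = of_real (w \<alpha>)"
  "(\<integral>k. complex_of_real (real_of_int k * p k) * cis \<alpha> powi k \<partial>count_space UNIV) = - \<i> * of_real (w' \<alpha>)"
  "(\<integral>k. complex_of_real ((real_of_int k)\<^sup>2 * p k) * cis \<alpha> powi k \<partial>count_space UNIV) = - of_real (w'' \<alpha>)"
proof -
  have int: "integrable (count_space UNIV) (\<lambda>k. complex_of_real (q k) * cis \<alpha> powi k)"
    if "integrable (count_space UNIV) q" for q
    by (rule Bochner_Integration.integrable_bound[OF that]) (auto simp: norm_mult norm_power_int)
  have cis: "cis \<alpha> powi k + cis \<alpha> powi (- k) = of_real (2 * cos (k * \<alpha>))"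
    "cis \<alpha> powi k - cis \<alpha> powi (- k) = \<i> * of_real (2 * sin (k * \<alpha>))" for k :: int
    unfolding cis_power_int by (auto simp: complex_eq_iff)
  show "(\<integral>k. complex_of_real (p k) * cis \<alpha> powi k \<partial>count_space UNIV) = of_real (w \<alpha>)"
  proof -
    have "complex_of_real (p (int (Suc k))) * cis \<alpha> powi (int (Suc k)) +
      complex_of_real (p (- int (Suc k))) * cis \<alpha> powi (- int (Suc k)) =
      of_real (weight_term \<V> k * cos (real (Suc k) * \<alpha>))" for k
      unfolding potential_even distrib_left[symmetric] cis weight_term_def by simp
    then show ?thesis
      unfolding integral_int_halves[OF int[OF integrable_p0]] spin_weight_alt
      using suminf_of_real[OF summable_trig(1), of \<alpha>, where 'a = complex] by simp
  qed
  show "(\<integral>k. complex_of_real (real_of_int k * p k) * cis \<alpha> powi k \<partial>count_space UNIV) = - \<i> * of_real (w' \<alpha>)"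
  proof -
    have "complex_of_real (real_of_int (int (Suc k)) * p (int (Suc k))) * cis \<alpha> powi (int (Suc k)) +
      complex_of_real (real_of_int (- int (Suc k)) * p (- int (Suc k))) * cis \<alpha> powi (- int (Suc k)) =
      - \<i> * of_real (- (weight_term \<V> k * real (Suc k) * sin (real (Suc k) * \<alpha>)))" (is "?l = ?r") for k
    proof -
      have "?l = complex_of_real (real (Suc k) * p (int (Suc k))) * (cis \<alpha> powi (int (Suc k)) - cis \<alpha> powi (- int (Suc k)))"
        unfolding potential_even by (simp add: algebra_simps)
      then show ?thesis
        unfolding cis weight_term_def by simp
    qed
    then show ?thesis
      unfolding integral_int_halves[OF int[OF integrable_p1]] spin_weight'_def
      using suminf_of_real[OF summable_trig(2), of \<alpha>, where 'a = complex]
        suminf_mult[OF summable_of_real[OF summable_trig(2)[of \<alpha>], where 'a = complex], of "- \<i>"] by simp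
  qed
  show "(\<integral>k. complex_of_real ((real_of_int k)\<^sup>2 * p k) * cis \<alpha> powi k \<partial>count_space UNIV) = - of_real (w'' \<alpha>)"
  proof -
    have "complex_of_real ((real_of_int (int (Suc k)))\<^sup>2 * p (int (Suc k))) * cis \<alpha> powi (int (Suc k)) +
      complex_of_real ((real_of_int (- int (Suc k)))\<^sup>2 * p (- int (Suc k))) * cis \<alpha> powi (- int (Suc k)) =
      - of_real (- (weight_term \<V> k * (real (Suc k))\<^sup>2 * cos (real (Suc k) * \<alpha>)))" (is "?l = ?r") for k
    proof -
      have "?l = complex_of_real ((real (Suc k))\<^sup>2 * p (int (Suc k))) * (cis \<alpha> powi (int (Suc k)) + cis \<alpha> powi (- int (Suc k)))"
        unfolding potential_even by (simp add: distrib_left del: of_nat_Suc)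
      then show ?thesis
        unfolding cis weight_term_def by simp
    qed
    then show ?thesis
      unfolding integral_int_halves[OF int[OF integrable_p2]] spin_weight''_def
      using suminf_of_real[OF summable_trig(3), of \<alpha>, where 'a = complex]
        suminf_minus[OF summable_of_real[OF summable_trig(3)[of \<alpha>], where 'a = complex]] by simp
  qed
qed

end

section \<open>Two-point functions\<close>

lemma prod_two_factors:
  fixes \<rho> :: "'a \<Rightarrow> 'b::comm_monoid_mult"
  assumes "finite E" "e \<in> E" "e' \<in> E" "\<And>x. x \<in> E \<Longrightarrow> x \<noteq> e \<Longrightarrow> x \<noteq> e' \<Longrightarrow> \<rho> x = 1"
  shows "prod \<rho> E = (if e = e' then \<rho> e else \<rho> e * \<rho> e')"
proof -
  have "prod \<rho> E = prod \<rho> {e, e'}"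
    using assms by (intro prod.mono_neutral_right) auto
  then show ?thesis by simp
qed

lemma integral_double_sum:
  fixes F :: "'a \<Rightarrow> 'a \<Rightarrow> 'b \<Rightarrow> real"
  assumes int: "\<And>i j. i \<in> A \<Longrightarrow> j \<in> A \<Longrightarrow> integrable N (F i j)"
  shows "(\<integral>x. (\<Sum>i\<in>A. \<Sum>j\<in>A. c i j * F i j x) \<partial>N) = (\<Sum>i\<in>A. \<Sum>j\<in>A. c i j * (\<integral>x. F i j x \<partial>N))"
proof -
  have "(\<integral>x. (\<Sum>i\<in>A. \<Sum>j\<in>A. c i j * F i j x) \<partial>N) = (\<Sum>i\<in>A. \<integral>x. (\<Sum>j\<in>A. c i j * F i j x) \<partial>N)"
    by (rule Bochner_Integration.integral_sum)
      (intro Bochner_Integration.integrable_sum integrable_mult_right int)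
  also have "\<dots> = (\<Sum>i\<in>A. \<Sum>j\<in>A. \<integral>x. c i j * F i j x \<partial>N)"
    by (intro sum.cong refl Bochner_Integration.integral_sum integrable_mult_right int)
  finally show ?thesis by simp
qed

context height_potential
begin

definition log_deriv :: "circle \<Rightarrow> real" where
  "log_deriv z = w' (angle z) / w (angle z)"

definition deriv2_ratio :: "circle \<Rightarrow> real" where
  "deriv2_ratio z = w'' (angle z) / w (angle z)"

text \<open>The mixed second derivative of the product of the edge weights in the angles at
  \<open>e\<close> and \<open>e'\<close>, regarded as independent variables, divided by that
  product.\<close>

definition pair_ratio :: "'e \<Rightarrow> 'e \<Rightarrow> ('e \<Rightarrow> circle) \<Rightarrow> real" where
  "pair_ratio e e' J = (if e = e' then deriv2_ratio (J e) else log_deriv (J e) * log_deriv (J e'))"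

text \<open>The weight is pulled out of every moment so that the product over the edges displays
  \<open>current_weight\<close> as a common density.\<close>

lemma fourier_factor:
  assumes "d \<le> 2"
  shows "(\<integral>k. complex_of_real (real_of_int k ^ d * p k) * Rep_circle z powi k \<partial>count_space UNIV) =
    of_real (w (angle z)) *
      (if d = 0 then 1 else if d = 1 then - \<i> * of_real (log_deriv z) else - of_real (deriv2_ratio z))"
proof -
  have "d = 0 \<or> d = 1 \<or> d = 2" using assms by auto
  then show ?thesis
    unfolding Rep_circle_angle[of z]
    using weight_fourier[of "angle z"] weight_pos[of "angle z"]
    by (elim disjE) (simp_all add: log_deriv_def deriv2_ratio_def)
qed

lemma height_weight_prod: "height_weight E \<V> n = (\<Prod>e\<in>E. p (n e))"
  unfolding height_weight_def by (rule exp_neg_sum) (simp_all add: potential_not_minus_infinity)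

lemma height_weight_nonneg: "0 \<le> height_weight E \<V> n"
  unfolding height_weight_prod by (intro prod_nonneg) (simp add: p_nonneg)

lemma integrable_moment:
  assumes "d \<le> 2"
  shows "integrable (count_space UNIV) (\<lambda>k. complex_of_real (real_of_int k ^ d * p k))"
proof -
  have "d = 0 \<or> d = 1 \<or> d = 2" using assms by auto
  then have "integrable (count_space UNIV) (\<lambda>k. real_of_int k ^ d * p k)"
    using integrable_p0 integrable_p1 integrable_p2 by auto
  then show ?thesis by (rule integrable_of_real)
qed

text \<open>Leaving the exponents \<open>d\<close> free covers the partition function and all
  two-point functions by a single application of the duality.\<close>

lemma
  fixes E :: "('v::finite \<times> 'v) set"
  assumes E: "oriented_graph E" "connected_graph E" and haar: "haar_prob (H_Diamond E) M"
    and d: "\<And>e. d e \<le> 2"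
  shows integrable_height_moment:
      "integrable (count_space (H_star E)) (\<lambda>n. (\<Prod>e\<in>E. real_of_int (n e) ^ d e) * height_weight E \<V> n)"
    and height_moment:
      "complex_of_real (\<integral>n. (\<Prod>e\<in>E. real_of_int (n e) ^ d e) * height_weight E \<V> n \<partial>count_space (H_star E)) =
       (\<integral>J. of_real (current_weight E \<V> J) * (\<Prod>e\<in>E. if d e = 0 then 1
          else if d e = 1 then - \<i> * of_real (log_deriv (J e)) else - of_real (deriv2_ratio (J e))) \<partial>M)"
proof -
  let ?q = "\<lambda>e k. complex_of_real (real_of_int k ^ d e * p k)"
  have eq: "(\<Prod>e\<in>E. ?q e (n e)) = of_real ((\<Prod>e\<in>E. real_of_int (n e) ^ d e) * height_weight E \<V> n)" for n
    by (simp add: height_weight_prod prod.distrib)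
  have int: "integrable (count_space UNIV) (?q e)" for e
    by (rule integrable_moment[OF d])
  from integrable_height_dual[OF E haar, where q = ?q, OF int]
  have *: "integrable (count_space (H_star E)) (\<lambda>n. complex_of_real ((\<Prod>e\<in>E. real_of_int (n e) ^ d e) * height_weight E \<V> n))"
    unfolding eq .
  from integrable_Re[OF this]
  show "integrable (count_space (H_star E)) (\<lambda>n. (\<Prod>e\<in>E. real_of_int (n e) ^ d e) * height_weight E \<V> n)"
    by (simp only: Re_complex_of_real)
  have "complex_of_real (\<integral>n. (\<Prod>e\<in>E. real_of_int (n e) ^ d e) * height_weight E \<V> n \<partial>count_space (H_star E)) =
    (\<integral>n. (\<Prod>e\<in>E. ?q e (n e)) \<partial>count_space (H_star E))"
    unfolding eq by (rule integral_complex_of_real[symmetric])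
  also have "\<dots> = (\<integral>J. (\<Prod>e\<in>E. \<integral>k. ?q e k * Rep_circle (J e) powi k \<partial>count_space UNIV) \<partial>M)"
    by (rule integral_height_dual[OF E haar, where q = ?q, OF int])
  finally show "complex_of_real (\<integral>n. (\<Prod>e\<in>E. real_of_int (n e) ^ d e) * height_weight E \<V> n \<partial>count_space (H_star E)) =
       (\<integral>J. of_real (current_weight E \<V> J) * (\<Prod>e\<in>E. if d e = 0 then 1
          else if d e = 1 then - \<i> * of_real (log_deriv (J e)) else - of_real (deriv2_ratio (J e))) \<partial>M)"
    unfolding fourier_factor[OF d] by (simp add: current_weight_def prod.distrib)
qed

text \<open>With all exponents zero, the duality identifies the normalising constants of the two
  measures.\<close>

lemma
  fixes E :: "('v::finite \<times> 'v) set"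
  assumes E: "oriented_graph E" "connected_graph E" and haar: "haar_prob (H_Diamond E) M"
  shows integrable_height_weight: "integrable (count_space (H_star E)) (height_weight E \<V>)"
    and partition_function_dual:
      "(\<integral>n. height_weight E \<V> n \<partial>count_space (H_star E)) = (\<integral>J. current_weight E \<V> J \<partial>M)"
proof -
  show "integrable (count_space (H_star E)) (height_weight E \<V>)"
    using integrable_height_moment[OF assms, of "\<lambda>_. 0"] by simp
  have "complex_of_real (\<integral>n. height_weight E \<V> n \<partial>count_space (H_star E)) =
      complex_of_real (\<integral>J. current_weight E \<V> J \<partial>M)"
    using height_moment[OF assms, of "\<lambda>_. 0"] by simp
  then show "(\<integral>n. height_weight E \<V> n \<partial>count_space (H_star E)) = (\<integral>J. current_weight E \<V> J \<partial>M)"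
    by (simp only: of_real_eq_iff)
qed

text \<open>One factor is attached to each of the two edges. Both cases yield a minus sign: two
  distinct edges through \<open>(-i)^2\<close>, a repeated edge through the Fourier series of the
  second moment.\<close>

lemma
  fixes E :: "('v::finite \<times> 'v) set"
  assumes E: "oriented_graph E" "connected_graph E" and haar: "haar_prob (H_Diamond E) M"
    and e: "e \<in> E" "e' \<in> E"
  shows integrable_two_point:
      "integrable (count_space (H_star E)) (\<lambda>n. real_of_int (n e) * real_of_int (n e') * height_weight E \<V> n)"
    and two_point_dual:
      "(\<integral>n. real_of_int (n e) * real_of_int (n e') * height_weight E \<V> n \<partial>count_space (H_star E)) =
       - (\<integral>J. pair_ratio e e' J * current_weight E \<V> J \<partial>M)"
proof -
  define d :: "'v \<times> 'v \<Rightarrow> nat" where "d x = of_bool (x = e) + of_bool (x = e')" for x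
  have d: "d x \<le> 2" for x by (auto simp: d_def)
  have n: "(\<Prod>x\<in>E. real_of_int (n x) ^ d x) = real_of_int (n e) * real_of_int (n e')" for n
    using e by (subst prod_two_factors[of E e e']) (auto simp: d_def power2_eq_square[symmetric])
  have J: "(\<Prod>x\<in>E. if d x = 0 then 1 else if d x = 1 then - \<i> * of_real (log_deriv (J x))
      else - of_real (deriv2_ratio (J x))) = complex_of_real (- pair_ratio e e' J)" for J
    using e by (subst prod_two_factors[of E e e']) (auto simp: d_def pair_ratio_def complex_eq_iff)
  show "integrable (count_space (H_star E)) (\<lambda>n. real_of_int (n e) * real_of_int (n e') * height_weight E \<V> n)"
    using integrable_height_moment[OF E haar, of d] d by (simp add: n)
  have "complex_of_real (\<integral>n. real_of_int (n e) * real_of_int (n e') * height_weight E \<V> n \<partial>count_space (H_star E)) =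
    (\<integral>J. complex_of_real (- (pair_ratio e e' J * current_weight E \<V> J)) \<partial>M)"
    using height_moment[OF E haar, of d] d unfolding n J by (simp add: mult_ac)
  also have "\<dots> = complex_of_real (- (\<integral>J. pair_ratio e e' J * current_weight E \<V> J \<partial>M))"
    by (subst integral_complex_of_real) simp
  finally show "(\<integral>n. real_of_int (n e) * real_of_int (n e') * height_weight E \<V> n \<partial>count_space (H_star E)) =
       - (\<integral>J. pair_ratio e e' J * current_weight E \<V> J \<partial>M)"
    by (simp only: of_real_eq_iff)
qed

section \<open>Measurability and boundedness of the circle-valued integrands\<close>

lemma abs_angle_le: "\<bar>angle z\<bar> \<le> pi"
  unfolding angle_def using Arg_bounded[of "Rep_circle z"] by linarith

lemma measurable_angle:
  assumes "haar_prob H M"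
  shows "(\<lambda>J. angle (J e)) \<in> borel_measurable M"
proof -
  \<comment> \<open>\<open>Arg\<close> jumps at the negative axis. The function \<open>A\<close> is
    constant on that closed set and continuous off it, and the circle meets the set only at -1,
    where the angle is pi.\<close>
  define A where "A z = (if z \<in> - \<real>\<^sub>\<le>\<^sub>0 then Arg z else pi)" for z
  have "A \<in> borel_measurable borel"
    unfolding A_def
  proof (rule borel_measurable_continuous_on_if)
    show "continuous_on (- \<real>\<^sub>\<le>\<^sub>0) Arg"
      by (intro continuous_at_imp_continuous_on ballI continuous_at_Arg) auto
  qed auto
  from measurable_compose[OF measurable_coordinate[OF assms] this]
  have "(\<lambda>J. A (Rep_circle (J e))) \<in> borel_measurable M" .
  moreover have "A (Rep_circle z) = angle z" for z
  proof (cases "Rep_circle z \<in> \<real>\<^sub>\<le>\<^sub>0")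
    case True
    then have "Re (Rep_circle z) < 0 \<and> Im (Rep_circle z) = 0"
      using Rep_circle_neq_0[of z] by (auto simp: complex_nonpos_Reals_iff complex_eq_iff)
    then show ?thesis
      using True Arg_eq_pi[THEN iffD2, of "Rep_circle z"] by (simp add: A_def angle_def)
  qed (simp add: A_def angle_def)
  ultimately show ?thesis by simp
qed

lemma
  assumes "haar_prob H M"
  shows measurable_weight: "(\<lambda>J. w (angle (J e))) \<in> borel_measurable M"
    and measurable_log_deriv: "(\<lambda>J. log_deriv (J e)) \<in> borel_measurable M"
    and measurable_deriv2_ratio: "(\<lambda>J. deriv2_ratio (J e)) \<in> borel_measurable M"
  using measurable_compose[OF measurable_angle[OF assms] borel_w(1)]
    measurable_compose[OF measurable_angle[OF assms] borel_w(2)]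
    measurable_compose[OF measurable_angle[OF assms] borel_w(3)]
  unfolding log_deriv_def deriv2_ratio_def by measurable

lemma ratio_bound:
  obtains D where "\<And>z. \<bar>log_deriv z\<bar> \<le> D" "\<And>z. \<bar>deriv2_ratio z\<bar> \<le> D"
proof -
  obtain c B where c: "0 < c" "\<And>\<alpha>. \<bar>\<alpha>\<bar> \<le> pi \<Longrightarrow> c \<le> w \<alpha>"
    and B: "\<And>\<alpha>. \<bar>w \<alpha>\<bar> \<le> B" "\<And>\<alpha>. \<bar>w' \<alpha>\<bar> \<le> B" "\<And>\<alpha>. \<bar>w'' \<alpha>\<bar> \<le> B"
    using weight_bounds by metis
  have "\<bar>x / w (angle z)\<bar> \<le> B / c" if "\<bar>x\<bar> \<le> B" for x z
    using c(1) c(2)[OF abs_angle_le, of z] weight_pos[of "angle z"] that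
    by (simp add: abs_divide) (intro frac_le, auto)
  with B that[of "B / c"] show ?thesis
    by (simp add: log_deriv_def deriv2_ratio_def)
qed

lemma integrable_current_weight:
  fixes E :: "('v::finite \<times> 'v) set"
  assumes "haar_prob (H_Diamond E) M"
    and "\<phi> \<in> borel_measurable M" "\<And>J. \<bar>\<phi> J\<bar> \<le> D"
  shows "integrable M (\<lambda>J. \<phi> J * current_weight E \<V> J)"
proof -
  interpret prob_space M using assms(1) by (simp add: haar_prob_def)
  obtain c B where B: "\<And>\<alpha>. \<bar>w \<alpha>\<bar> \<le> B"
    using weight_bounds by metis
  have W: "\<bar>current_weight E \<V> J\<bar> \<le> B ^ card E" for J
    unfolding current_weight_def abs_prod using B prod_mono[of E "\<lambda>e. \<bar>w (angle (J e))\<bar>" "\<lambda>_. B"] by simp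
  show ?thesis
  proof (rule integrable_const_bound)
    have "\<bar>\<phi> J * current_weight E \<V> J\<bar> \<le> D * B ^ card E" for J
      unfolding abs_mult using assms(3)[of J] W[of J] by (intro mult_mono) auto
    then show "AE J in M. norm (\<phi> J * current_weight E \<V> J) \<le> D * B ^ card E" by simp
    show "(\<lambda>J. \<phi> J * current_weight E \<V> J) \<in> borel_measurable M"
      unfolding current_weight_def
      using assms(2) measurable_weight[OF assms(1)] by (intro borel_measurable_times borel_measurable_prod)
  qed
qed

section \<open>Expectations under the two probability measures\<close>

lemma current_weight_pos: "0 < current_weight E \<V> J"
  unfolding current_weight_def by (intro prod_pos) (simp add: weight_pos)

lemma current_partition_pos:
  fixes E :: "('v::finite \<times> 'v) set"
  assumes "haar_prob (H_Diamond E) M"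
  shows "0 < (\<integral>J. current_weight E \<V> J \<partial>M)"
proof -
  interpret prob_space M using assms by (simp add: haar_prob_def)
  have int: "integrable M (current_weight E \<V>)"
    using integrable_current_weight[OF assms, of "\<lambda>_. 1" 1] by simp
  have "(\<integral>J. current_weight E \<V> J \<partial>M) \<noteq> 0"
  proof
    assume "(\<integral>J. current_weight E \<V> J \<partial>M) = 0"
    then have "AE J in M. current_weight E \<V> J = 0"
      using integral_nonneg_eq_0_iff_AE[OF int] current_weight_pos[of E] by (simp add: less_imp_le)
    then show False
      using current_weight_pos[of E] by (simp add: less_imp_neq[symmetric])
  qed
  moreover have "0 \<le> (\<integral>J. current_weight E \<V> J \<partial>M)"
    using current_weight_pos[of E] by (intro integral_nonneg_AE) (simp add: less_imp_le)
  ultimately show ?thesis by simp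
qed

lemma integral_mu_Diamond:
  fixes E :: "('v::finite \<times> 'v) set"
  assumes "haar_prob (H_Diamond E) M" "\<phi> \<in> borel_measurable M"
  shows "(\<integral>J. \<phi> J \<partial>mu_Diamond E \<V> M) =
    (\<integral>J. \<phi> J * current_weight E \<V> J \<partial>M) / (\<integral>J. current_weight E \<V> J \<partial>M)"
proof -
  let ?Z = "\<integral>J. current_weight E \<V> J \<partial>M"
  have "(\<lambda>J. current_weight E \<V> J / ?Z) \<in> borel_measurable M"
    unfolding current_weight_def
    using measurable_weight[OF assms(1)] by (intro borel_measurable_divide borel_measurable_prod) auto
  then have "(\<integral>J. \<phi> J \<partial>mu_Diamond E \<V> M) = (\<integral>J. (current_weight E \<V> J / ?Z) *\<^sub>R \<phi> J \<partial>M)"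
    unfolding mu_Diamond_def
    using assms(2) current_weight_pos[of E] current_partition_pos[OF assms(1)]
    by (intro integral_density) (auto simp: less_imp_le)
  also have "\<dots> = (\<integral>J. \<phi> J * current_weight E \<V> J / ?Z \<partial>M)"
    by (rule Bochner_Integration.integral_cong) auto
  finally show ?thesis by simp
qed

text \<open>The normalising sum is replaced by the Haar integral of the current weight, so
  expectations under both measures carry the same denominator.\<close>

lemma
  fixes E :: "('v::finite \<times> 'v) set" and \<phi> :: "('v \<times> 'v \<Rightarrow> int) \<Rightarrow> real"
  assumes "oriented_graph E" "connected_graph E" "haar_prob (H_Diamond E) M"
  shows integrable_nu_star: "integrable (nu_star E \<V>) \<phi> \<longleftrightarrow>
      integrable (count_space (H_star E)) (\<lambda>n. \<phi> n * height_weight E \<V> n)"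
    and integral_nu_star: "(\<integral>n. \<phi> n \<partial>nu_star E \<V>) =
      (\<integral>n. \<phi> n * height_weight E \<V> n \<partial>count_space (H_star E)) / (\<integral>J. current_weight E \<V> J \<partial>M)"
proof -
  let ?Z = "\<integral>J. current_weight E \<V> J \<partial>M"
  have Z: "infsum (height_weight E \<V>) (H_star E) = ?Z"
    using infsetsum_infsum[of "height_weight E \<V>" "H_star E"] integrable_height_weight[OF assms]
      partition_function_dual[OF assms]
    by (simp add: abs_summable_on_def infsetsum_def)
  have pos: "0 < ?Z" by (rule current_partition_pos[OF assms(3)])
  have nu: "nu_star E \<V> = density (count_space (H_star E)) (\<lambda>n. ennreal (height_weight E \<V> n / ?Z))"
    by (simp add: nu_star_def point_measure_def Z)
  have eq: "(height_weight E \<V> n / ?Z) *\<^sub>R \<phi> n = \<phi> n * height_weight E \<V> n / ?Z" for n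
    by simp
  show "integrable (nu_star E \<V>) \<phi> \<longleftrightarrow>
      integrable (count_space (H_star E)) (\<lambda>n. \<phi> n * height_weight E \<V> n)"
    unfolding nu using height_weight_nonneg[of E] pos
      integrable_mult_left_iff[of "count_space (H_star E)" "1 / ?Z" "\<lambda>n. \<phi> n * height_weight E \<V> n"]
    by (subst integrable_density) (auto simp: mult.commute)
  have "(\<integral>n. \<phi> n \<partial>nu_star E \<V>) = (\<integral>n. (height_weight E \<V> n / ?Z) *\<^sub>R \<phi> n \<partial>count_space (H_star E))"
    unfolding nu using height_weight_nonneg[of E] pos
    by (intro integral_density) auto
  then show "(\<integral>n. \<phi> n \<partial>nu_star E \<V>) =
      (\<integral>n. \<phi> n * height_weight E \<V> n \<partial>count_space (H_star E)) / ?Z"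
    unfolding eq by simp
qed

text \<open>On the diagonal \<open>w'' / w\<close> is the squared logarithmic derivative minus the
  second derivative of the potential. The squared parts complete the off-diagonal products to a
  perfect square.\<close>

lemma sum_pair_ratio:
  assumes "finite E"
  shows "(\<Sum>e\<in>E. \<Sum>e'\<in>E. a e * a e' * pair_ratio e e' J) =
    (\<Sum>e\<in>E. a e * log_deriv (J e))\<^sup>2 -
    (\<Sum>e\<in>E. (a e)\<^sup>2 * deriv (deriv (dual_spin_potential \<V>)) (angle (J e)))"
proof -
  let ?r = "\<lambda>e. log_deriv (J e)"
  let ?U = "\<lambda>e. deriv (deriv (dual_spin_potential \<V>)) (angle (J e))"
  have "(\<Sum>e'\<in>E. a e * a e' * pair_ratio e e' J) =
      (\<Sum>e'\<in>E. (a e * ?r e) * (a e' * ?r e')) - (a e)\<^sup>2 * ?U e" if "e \<in> E" for e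
  proof -
    have "a e * a e' * pair_ratio e e' J =
        (a e * ?r e) * (a e' * ?r e') - (if e' = e then (a e)\<^sup>2 * ?U e else 0)" for e'
      by (simp add: pair_ratio_def dual_potential_deriv2 log_deriv_def deriv2_ratio_def
          power2_eq_square algebra_simps)
    then show ?thesis using assms that by (simp add: sum_subtractf)
  qed
  then show ?thesis
    by (simp add: sum_subtractf power2_eq_square sum_product)
qed

text \<open>Integrability is included because the Bochner integral of a non-integrable function is
  0, in which case the inequality would say nothing about the second moment.\<close>

lemma variance_bound:
  fixes E :: "('v::finite \<times> 'v) set" and a :: "'v \<times> 'v \<Rightarrow> real"
  assumes E: "oriented_graph E" "connected_graph E" and haar: "haar_prob (H_Diamond E) M"
  shows "integrable (nu_star E \<V>) (\<lambda>n. (\<Sum>e\<in>E. real_of_int (n e) * a e)\<^sup>2)"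
    and "(\<integral>n. (\<Sum>e\<in>E. real_of_int (n e) * a e)\<^sup>2 \<partial>nu_star E \<V>) \<le>
      (\<Sum>e\<in>E. (a e)\<^sup>2 * (\<integral>J. deriv (deriv (dual_spin_potential \<V>)) (angle (J e)) \<partial>mu_Diamond E \<V> M))"
proof -
  let ?Z = "\<integral>J. current_weight E \<V> J \<partial>M"
  let ?W = "current_weight E \<V>"
  let ?H = "count_space (H_star E) :: ('v \<times> 'v \<Rightarrow> int) measure"
  let ?U = "\<lambda>J e. deriv (deriv (dual_spin_potential \<V>)) (angle (J e))"
  obtain D where D: "\<And>z. \<bar>log_deriv z\<bar> \<le> D" "\<And>z. \<bar>deriv2_ratio z\<bar> \<le> D"
    using ratio_bound by blast
  have D0: "0 \<le> D" using order_trans[OF abs_ge_zero D(1)] .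
  have meas [measurable]: "(\<lambda>J. log_deriv (J e)) \<in> borel_measurable M"
      "(\<lambda>J. deriv2_ratio (J e)) \<in> borel_measurable M" for e
    using measurable_log_deriv[OF haar] measurable_deriv2_ratio[OF haar] by auto
  have rr: "\<bar>log_deriv z * log_deriv z'\<bar> \<le> D * D" for z z'
    unfolding abs_mult using D D0 by (intro mult_mono) auto
  have U: "?U J e = log_deriv (J e) * log_deriv (J e) - deriv2_ratio (J e)" for J e
    by (simp add: dual_potential_deriv2 log_deriv_def deriv2_ratio_def power2_eq_square)
  have Um: "(\<lambda>J. ?U J e) \<in> borel_measurable M" for e
    unfolding U by measurable
  have intU: "integrable M (\<lambda>J. ?U J e * ?W J)" for e
  proof (rule integrable_current_weight[OF haar Um])
    show "\<bar>?U J e\<bar> \<le> D * D + D" for J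
      unfolding U using rr[of "J e" "J e"] D(2)[of "J e"] by linarith
  qed
  have intK: "integrable M (\<lambda>J. pair_ratio e e' J * ?W J)" for e e'
  proof (rule integrable_current_weight[OF haar])
    show "pair_ratio e e' \<in> borel_measurable M"
      unfolding pair_ratio_def[abs_def] by (cases "e = e'") simp_all
    have "0 \<le> D * D" using D0 by simp
    then show "\<bar>pair_ratio e e' J\<bar> \<le> D * D + D" for J
      unfolding pair_ratio_def
      using add_mono[OF rr[of "J e" "J e'"] D0] add_mono[OF _ D(2)[of "J e"], of 0] by auto
  qed
  have expand: "(\<Sum>e\<in>E. real_of_int (n e) * a e)\<^sup>2 * height_weight E \<V> n =
      (\<Sum>e\<in>E. \<Sum>e'\<in>E. a e * a e' * (real_of_int (n e) * real_of_int (n e') * height_weight E \<V> n))" for n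
    unfolding power2_eq_square sum_product
    unfolding sum_distrib_right by (intro sum.cong refl) (simp add: mult_ac)
  have int2: "integrable ?H (\<lambda>n. a e * a e' * (real_of_int (n e) * real_of_int (n e') * height_weight E \<V> n))"
    if "e \<in> E" "e' \<in> E" for e e'
    using integrable_two_point[OF E haar that] by simp
  show "integrable (nu_star E \<V>) (\<lambda>n. (\<Sum>e\<in>E. real_of_int (n e) * a e)\<^sup>2)"
    unfolding integrable_nu_star[OF assms] expand
    by (intro Bochner_Integration.integrable_sum int2)
  have "(\<integral>n. (\<Sum>e\<in>E. real_of_int (n e) * a e)\<^sup>2 * height_weight E \<V> n \<partial>?H) =
    (\<Sum>e\<in>E. \<Sum>e'\<in>E. a e * a e' * (\<integral>n. real_of_int (n e) * real_of_int (n e') * height_weight E \<V> n \<partial>?H))"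
    unfolding expand by (intro integral_double_sum integrable_two_point[OF E haar])
  also have "\<dots> = - (\<Sum>e\<in>E. \<Sum>e'\<in>E. a e * a e' * (\<integral>J. pair_ratio e e' J * ?W J \<partial>M))"
    unfolding sum_negf[symmetric]
    by (intro sum.cong refl) (simp add: two_point_dual[OF E haar])
  also have "\<dots> = - (\<integral>J. (\<Sum>e\<in>E. \<Sum>e'\<in>E. a e * a e' * (pair_ratio e e' J * ?W J)) \<partial>M)"
    using integral_double_sum[of E M "\<lambda>e e' J. pair_ratio e e' J * ?W J" "\<lambda>e e'. a e * a e'"] intK by simp
  also have "\<dots> = - (\<integral>J. (\<Sum>e\<in>E. a e * log_deriv (J e))\<^sup>2 * ?W J - (\<Sum>e\<in>E. (a e)\<^sup>2 * (?U J e * ?W J)) \<partial>M)"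
  proof -
    have "(\<Sum>e\<in>E. \<Sum>e'\<in>E. a e * a e' * (pair_ratio e e' J * ?W J)) =
        (\<Sum>e\<in>E. \<Sum>e'\<in>E. a e * a e' * pair_ratio e e' J) * ?W J" for J
      unfolding sum_distrib_right by (intro sum.cong refl) (simp add: mult_ac)
    also have "\<dots> J = (\<Sum>e\<in>E. a e * log_deriv (J e))\<^sup>2 * ?W J - (\<Sum>e\<in>E. (a e)\<^sup>2 * (?U J e * ?W J))" for J
      by (subst sum_pair_ratio) (simp_all add: left_diff_distrib sum_distrib_right mult.assoc)
    finally show ?thesis by simp
  qed
  also have "\<dots> = (\<Sum>e\<in>E. (a e)\<^sup>2 * (\<integral>J. ?U J e * ?W J \<partial>M)) - (\<integral>J. (\<Sum>e\<in>E. a e * log_deriv (J e))\<^sup>2 * ?W J \<partial>M)"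
  proof -
    have "integrable M (\<lambda>J. (\<Sum>e\<in>E. a e * log_deriv (J e))\<^sup>2 * ?W J)"
    proof (rule integrable_current_weight[OF haar])
      show "(\<lambda>J. (\<Sum>e\<in>E. a e * log_deriv (J e))\<^sup>2) \<in> borel_measurable M" by measurable
      have "\<bar>\<Sum>e\<in>E. a e * log_deriv (J e)\<bar> \<le> (\<Sum>e\<in>E. \<bar>a e\<bar> * D)" for J
        by (rule order_trans[OF sum_abs]) (intro sum_mono, simp add: abs_mult mult_left_mono D)
      then have "\<bar>\<Sum>e\<in>E. a e * log_deriv (J e)\<bar>\<^sup>2 \<le> (\<Sum>e\<in>E. \<bar>a e\<bar> * D)\<^sup>2" for J
        by (rule power_mono) simp
      then show "\<bar>(\<Sum>e\<in>E. a e * log_deriv (J e))\<^sup>2\<bar> \<le> (\<Sum>e\<in>E. \<bar>a e\<bar> * D)\<^sup>2" for J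
        by simp
    qed
    then show ?thesis using intU by simp
  qed
  \<comment> \<open>The discarded term is the integral of a square against a positive
    weight.\<close>
  also have "\<dots> \<le> (\<Sum>e\<in>E. (a e)\<^sup>2 * (\<integral>J. ?U J e * ?W J \<partial>M))"
  proof -
    have "0 \<le> (\<integral>J. (\<Sum>e\<in>E. a e * log_deriv (J e))\<^sup>2 * ?W J \<partial>M)"
      using current_weight_pos[of E] by (intro integral_nonneg_AE AE_I2 mult_nonneg_nonneg) (simp_all add: less_imp_le)
    then show ?thesis by simp
  qed
  finally have "(\<integral>n. (\<Sum>e\<in>E. real_of_int (n e) * a e)\<^sup>2 \<partial>nu_star E \<V>) \<le>
      (\<Sum>e\<in>E. (a e)\<^sup>2 * (\<integral>J. ?U J e * ?W J \<partial>M)) / ?Z"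
    unfolding integral_nu_star[OF assms] using current_partition_pos[OF haar] by (simp add: divide_right_mono)
  also have "\<dots> = (\<Sum>e\<in>E. (a e)\<^sup>2 * (\<integral>J. ?U J e \<partial>mu_Diamond E \<V> M))"
    unfolding integral_mu_Diamond[OF haar Um] by (simp add: sum_divide_distrib)
  finally show "(\<integral>n. (\<Sum>e\<in>E. real_of_int (n e) * a e)\<^sup>2 \<partial>nu_star E \<V>) \<le>
      (\<Sum>e\<in>E. (a e)\<^sup>2 * (\<integral>J. ?U J e \<partial>mu_Diamond E \<V> M))" .
qed

end

theorem corollary3p1:
  fixes E :: "('v::finite \<times> 'v) set"
    and b :: 'v
    and \<V> :: "int \<Rightarrow> ereal"
    and \<U> :: "real \<Rightarrow> real"
    and haar :: "('v \<times> 'v \<Rightarrow> circle) measure"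
    and C :: real
    and f :: "'v \<Rightarrow> real"
  assumes "oriented_graph E" and "connected_graph E"
    and "height_function_potential \<V>"
    and "\<U> = dual_spin_potential \<V>"
    and "haar_prob (H_Diamond E) haar"
    and "C = (SUP e\<in>E. \<bar>\<integral>J. deriv (deriv \<U>) (angle (J e)) \<partial>mu_Diamond E \<V> haar\<bar>)"
    and "f \<in> Omega00 b"
  shows "integrable (nu_star E \<V>) (\<lambda>n. (inner0 (\<lambda>v. real_of_int (height_fun E b n v)) f)\<^sup>2) \<and>
    (\<integral>n. (inner0 (\<lambda>v. real_of_int (height_fun E b n v)) f)\<^sup>2 \<partial>nu_star E \<V>)
           \<le> C * inner0 (Laplace_inv E b f) f \<and>
    C * inner0 (Laplace_inv E b f) f
           = C * (\<Sum>v\<in>UNIV. \<Sum>v'\<in>UNIV. f v * f v' * (Green E b v v' / real (deg E v')))"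
proof -
  note E = assms(1,2) and haar = assms(5) and f = assms(7)
  interpret height_potential \<V>
    using assms(3) by unfold_locales
  define a where "a = diff E (Laplace_inv E b f)"
  let ?\<mu> = "\<lambda>e. \<integral>J. deriv (deriv \<U>) (angle (J e)) \<partial>mu_Diamond E \<V> haar"
  \<comment> \<open>Summation by parts with the height vanishing at \<open>b\<close> makes the
    observable linear in the gradient.\<close>
  have height: "inner0 (\<lambda>v. real_of_int (height_fun E b n v)) f = (\<Sum>e\<in>E. real_of_int (n e) * a e)"
    if "n \<in> H_star E" for n
  proof -
    have "diff E (\<lambda>v. real_of_int (height_fun E b n v)) e = real_of_int (diff E (height_fun E b n) e)" for e
      by (simp add: diff_def split: prod.split)
    then show ?thesis
      using height_fun[OF E(2) that, of b] by (simp add: inner0_Laplace_inv[OF E f] a_def)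
  qed
  have space: "space (nu_star E \<V>) = H_star E"
    by (simp add: nu_star_def space_point_measure)
  \<comment> \<open>The same identity, with the potential \<open>Laplace_inv E b f\<close> itself in
    the role of the height.\<close>
  have energy: "(\<Sum>e\<in>E. (a e)\<^sup>2) = inner0 (Laplace_inv E b f) f"
    using inner0_Laplace_inv[OF E f, of "Laplace_inv E b f"] Laplace_inv(1)[OF E f] by (simp add: a_def power2_eq_square)
  \<comment> \<open>The supremum runs over a finite set, so it bounds each absolute value and hence
    each signed expectation.\<close>
  have C: "?\<mu> e \<le> C" if "e \<in> E" for e
  proof -
    have "\<bar>?\<mu> e\<bar> \<le> C"
      unfolding assms(6) using that by (intro cSUP_upper) auto
    then show ?thesis by linarith
  qed
  have int: "integrable (nu_star E \<V>) (\<lambda>n. (inner0 (\<lambda>v. real_of_int (height_fun E b n v)) f)\<^sup>2)"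
    using variance_bound(1)[OF E haar, of a] height space
    by (subst Bochner_Integration.integrable_cong[OF refl]) auto
  have "(\<integral>n. (inner0 (\<lambda>v. real_of_int (height_fun E b n v)) f)\<^sup>2 \<partial>nu_star E \<V>) =
      (\<integral>n. (\<Sum>e\<in>E. real_of_int (n e) * a e)\<^sup>2 \<partial>nu_star E \<V>)"
    using height space by (intro Bochner_Integration.integral_cong) auto
  also have "\<dots> \<le> (\<Sum>e\<in>E. (a e)\<^sup>2 * ?\<mu> e)"
    using variance_bound(2)[OF E haar] by (simp add: assms(4))
  also have "\<dots> \<le> (\<Sum>e\<in>E. (a e)\<^sup>2 * C)"
    by (intro sum_mono mult_left_mono C) auto
  also have "\<dots> = C * inner0 (Laplace_inv E b f) f"
    unfolding energy[symmetric] by (simp add: sum_distrib_left mult.commute)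
  finally show ?thesis
    using int inner0_Laplace_inv_Green[OF E f] by simp
qed

end
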